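(* Work in intuitionistic (higher-order) type theory, i.e. the internal logic of an elementary topos. Let $B$ be a set, let $A$ be a finite, complemented, proper subset of $B$, and let $f: A \to B$ be a function. Then $B - \mathrm{Range}(f)$ is inhabited, i.e. there exists an element of $B$ not in the range of $f$.
   Context: Logic is intuitionistic (no law of excluded middle). A set $A$ is finite (Kuratowski-finite) if it belongs to every family $\mathcal{Y}$ of sets that contains $\emptyset$ and satisfies: whenever $Z \in \mathcal{Y}$ and $a \in A$, then $Z \cup \{a\} \in \mathcal{Y}$. A set is inhabited if there exists an element in it. A subset $A \subseteq B$ is proper if $B - A$ is inhabited. A subset $A \subseteq B$ is complemented in $B$ if $B = A \cup (B - A)$, i.e. every element of $B$ is either in $A$ or not in $A$. *)

theory Defs
  imports Main
begin

text \<open>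
  HOL is classical, so a statement about intuitionistic higher-order logic cannot be
  rendered as a plain HOL proposition without losing its content.  We therefore formalize
  intuitionistic type theory itself, the internal logic of elementary toposes in the style of
  Lambek and Scott, as a deductive system and speak about derivability in it.  There is no type of
  natural numbers, since an elementary topos need not have a natural numbers object.  Sequents
  carry an explicit context of variables, since types are not assumed to be inhabited.
\<close>

section \<open>Types and terms\<close>

text \<open>
  \<open>Ground g\<close> is an arbitrary uninterpreted type (an arbitrary object of a topos).
\<close>

datatype 'g ty =
    Ground 'g
  | One
  | Omega
  | Power "'g ty"
  | Times "'g ty" "'g ty"

text \<open>
  Variables are de Bruijn indices.  Formulas are the terms of type \<open>Omega\<close>;
  \<open>Compr A \<phi>\<close> is the set of all \<open>x : A\<close> such that \<open>\<phi>\<close>, where \<open>x\<close> is bound as index 0.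
\<close>

datatype 'g tm =
    Var nat
  | Star
  | Tuple "'g tm" "'g tm"
  | Compr "'g ty" "'g tm"
  | Mem "'g tm" "'g tm"  (infix "\<^bold>\<in>" 60)
  | Eq "'g tm" "'g tm"  (infix "\<^bold>=" 60)
  | Falsum  ("\<^bold>\<bottom>")
  | Conj "'g tm" "'g tm"  (infixr "\<^bold>\<and>" 55)
  | Disj "'g tm" "'g tm"  (infixr "\<^bold>\<or>" 54)
  | Imp "'g tm" "'g tm"  (infixr "\<^bold>\<longrightarrow>" 53)
  | Forall "'g ty" "'g tm"
  | Exists "'g ty" "'g tm"

definition Neg :: "'g tm \<Rightarrow> 'g tm"  ("\<^bold>\<not> _" [57] 57) where
  "\<^bold>\<not> \<phi> = (\<phi> \<^bold>\<longrightarrow> \<^bold>\<bottom>)"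

definition Iff :: "'g tm \<Rightarrow> 'g tm \<Rightarrow> 'g tm"  (infix "\<^bold>\<longleftrightarrow>" 52) where
  "(\<phi> \<^bold>\<longleftrightarrow> \<psi>) = ((\<phi> \<^bold>\<longrightarrow> \<psi>) \<^bold>\<and> (\<psi> \<^bold>\<longrightarrow> \<phi>))"

inductive has_type :: "'g ty list \<Rightarrow> 'g tm \<Rightarrow> 'g ty \<Rightarrow> bool"  ("_ \<turnstile> _ : _" [50, 51, 51] 50) where
  "n < length \<Gamma> \<Longrightarrow> \<Gamma> \<turnstile> Var n : \<Gamma> ! n"
| "\<Gamma> \<turnstile> Star : One"
| "\<Gamma> \<turnstile> s : A \<Longrightarrow> \<Gamma> \<turnstile> t : B \<Longrightarrow> \<Gamma> \<turnstile> Tuple s t : Times A B"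
| "A # \<Gamma> \<turnstile> \<phi> : Omega \<Longrightarrow> \<Gamma> \<turnstile> Compr A \<phi> : Power A"
| "\<Gamma> \<turnstile> s : A \<Longrightarrow> \<Gamma> \<turnstile> t : Power A \<Longrightarrow> \<Gamma> \<turnstile> (s \<^bold>\<in> t) : Omega"
| "\<Gamma> \<turnstile> s : A \<Longrightarrow> \<Gamma> \<turnstile> t : A \<Longrightarrow> \<Gamma> \<turnstile> (s \<^bold>= t) : Omega"
| "\<Gamma> \<turnstile> \<^bold>\<bottom> : Omega"
| "\<Gamma> \<turnstile> \<phi> : Omega \<Longrightarrow> \<Gamma> \<turnstile> \<psi> : Omega \<Longrightarrow> \<Gamma> \<turnstile> (\<phi> \<^bold>\<and> \<psi>) : Omega"
| "\<Gamma> \<turnstile> \<phi> : Omega \<Longrightarrow> \<Gamma> \<turnstile> \<psi> : Omega \<Longrightarrow> \<Gamma> \<turnstile> (\<phi> \<^bold>\<or> \<psi>) : Omega"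
| "\<Gamma> \<turnstile> \<phi> : Omega \<Longrightarrow> \<Gamma> \<turnstile> \<psi> : Omega \<Longrightarrow> \<Gamma> \<turnstile> (\<phi> \<^bold>\<longrightarrow> \<psi>) : Omega"
| "A # \<Gamma> \<turnstile> \<phi> : Omega \<Longrightarrow> \<Gamma> \<turnstile> Forall A \<phi> : Omega"
| "A # \<Gamma> \<turnstile> \<phi> : Omega \<Longrightarrow> \<Gamma> \<turnstile> Exists A \<phi> : Omega"

section \<open>Renaming and substitution\<close>

definition up_ren :: "(nat \<Rightarrow> nat) \<Rightarrow> nat \<Rightarrow> nat" where
  "up_ren r = case_nat 0 (\<lambda>n. Suc (r n))"

primrec ren :: "(nat \<Rightarrow> nat) \<Rightarrow> 'g tm \<Rightarrow> 'g tm" where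
  "ren r (Var n) = Var (r n)"
| "ren r Star = Star"
| "ren r (Tuple s t) = Tuple (ren r s) (ren r t)"
| "ren r (Compr A \<phi>) = Compr A (ren (up_ren r) \<phi>)"
| "ren r (s \<^bold>\<in> t) = (ren r s \<^bold>\<in> ren r t)"
| "ren r (s \<^bold>= t) = (ren r s \<^bold>= ren r t)"
| "ren r \<^bold>\<bottom> = \<^bold>\<bottom>"
| "ren r (\<phi> \<^bold>\<and> \<psi>) = (ren r \<phi> \<^bold>\<and> ren r \<psi>)"
| "ren r (\<phi> \<^bold>\<or> \<psi>) = (ren r \<phi> \<^bold>\<or> ren r \<psi>)"
| "ren r (\<phi> \<^bold>\<longrightarrow> \<psi>) = (ren r \<phi> \<^bold>\<longrightarrow> ren r \<psi>)"
| "ren r (Forall A \<phi>) = Forall A (ren (up_ren r) \<phi>)"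
| "ren r (Exists A \<phi>) = Exists A (ren (up_ren r) \<phi>)"

abbreviation lift :: "'g tm \<Rightarrow> 'g tm" where
  "lift \<equiv> ren Suc"

definition up_sub :: "(nat \<Rightarrow> 'g tm) \<Rightarrow> nat \<Rightarrow> 'g tm" where
  "up_sub \<sigma> = case_nat (Var 0) (\<lambda>n. lift (\<sigma> n))"

primrec sub :: "(nat \<Rightarrow> 'g tm) \<Rightarrow> 'g tm \<Rightarrow> 'g tm" where
  "sub \<sigma> (Var n) = \<sigma> n"
| "sub \<sigma> Star = Star"
| "sub \<sigma> (Tuple s t) = Tuple (sub \<sigma> s) (sub \<sigma> t)"
| "sub \<sigma> (Compr A \<phi>) = Compr A (sub (up_sub \<sigma>) \<phi>)"
| "sub \<sigma> (s \<^bold>\<in> t) = (sub \<sigma> s \<^bold>\<in> sub \<sigma> t)"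
| "sub \<sigma> (s \<^bold>= t) = (sub \<sigma> s \<^bold>= sub \<sigma> t)"
| "sub \<sigma> \<^bold>\<bottom> = \<^bold>\<bottom>"
| "sub \<sigma> (\<phi> \<^bold>\<and> \<psi>) = (sub \<sigma> \<phi> \<^bold>\<and> sub \<sigma> \<psi>)"
| "sub \<sigma> (\<phi> \<^bold>\<or> \<psi>) = (sub \<sigma> \<phi> \<^bold>\<or> sub \<sigma> \<psi>)"
| "sub \<sigma> (\<phi> \<^bold>\<longrightarrow> \<psi>) = (sub \<sigma> \<phi> \<^bold>\<longrightarrow> sub \<sigma> \<psi>)"
| "sub \<sigma> (Forall A \<phi>) = Forall A (sub (up_sub \<sigma>) \<phi>)"
| "sub \<sigma> (Exists A \<phi>) = Exists A (sub (up_sub \<sigma>) \<phi>)"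

definition inst :: "'g tm \<Rightarrow> 'g tm \<Rightarrow> 'g tm" where
  "inst \<phi> t = sub (case_nat t Var) \<phi>"

section \<open>Derivability\<close>

text \<open>
  \<open>\<Gamma> | H \<tturnstile> \<phi>\<close> means that \<open>\<phi>\<close> is derivable from the hypotheses \<open>H\<close>, with all free variables typed
  by \<open>\<Gamma>\<close>.  The typing premises guarantee that only well-typed formulas are derived from well-typed
  hypotheses.  Excluded middle and choice are absent.
\<close>

inductive derivable :: "'g ty list \<Rightarrow> 'g tm list \<Rightarrow> 'g tm \<Rightarrow> bool"
    ("_ | _ \<tturnstile> _" [50, 50, 50] 50) where
  hyp: "\<phi> \<in> set H \<Longrightarrow> \<Gamma> | H \<tturnstile> \<phi>"
| falsumE: "\<Gamma> | H \<tturnstile> \<^bold>\<bottom> \<Longrightarrow> \<Gamma> \<turnstile> \<phi> : Omega \<Longrightarrow> \<Gamma> | H \<tturnstile> \<phi>"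
| conjI: "\<Gamma> | H \<tturnstile> \<phi> \<Longrightarrow> \<Gamma> | H \<tturnstile> \<psi> \<Longrightarrow> \<Gamma> | H \<tturnstile> \<phi> \<^bold>\<and> \<psi>"
| conjE1: "\<Gamma> | H \<tturnstile> \<phi> \<^bold>\<and> \<psi> \<Longrightarrow> \<Gamma> | H \<tturnstile> \<phi>"
| conjE2: "\<Gamma> | H \<tturnstile> \<phi> \<^bold>\<and> \<psi> \<Longrightarrow> \<Gamma> | H \<tturnstile> \<psi>"
| disjI1: "\<Gamma> | H \<tturnstile> \<phi> \<Longrightarrow> \<Gamma> \<turnstile> \<psi> : Omega \<Longrightarrow> \<Gamma> | H \<tturnstile> \<phi> \<^bold>\<or> \<psi>"
| disjI2: "\<Gamma> | H \<tturnstile> \<psi> \<Longrightarrow> \<Gamma> \<turnstile> \<phi> : Omega \<Longrightarrow> \<Gamma> | H \<tturnstile> \<phi> \<^bold>\<or> \<psi>"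
| disjE: "\<Gamma> | H \<tturnstile> \<phi> \<^bold>\<or> \<psi> \<Longrightarrow> \<Gamma> | \<phi> # H \<tturnstile> \<chi> \<Longrightarrow> \<Gamma> | \<psi> # H \<tturnstile> \<chi> \<Longrightarrow> \<Gamma> | H \<tturnstile> \<chi>"
| impI: "\<Gamma> \<turnstile> \<phi> : Omega \<Longrightarrow> \<Gamma> | \<phi> # H \<tturnstile> \<psi> \<Longrightarrow> \<Gamma> | H \<tturnstile> \<phi> \<^bold>\<longrightarrow> \<psi>"
| impE: "\<Gamma> | H \<tturnstile> \<phi> \<^bold>\<longrightarrow> \<psi> \<Longrightarrow> \<Gamma> | H \<tturnstile> \<phi> \<Longrightarrow> \<Gamma> | H \<tturnstile> \<psi>"
| forallI: "A # \<Gamma> | map lift H \<tturnstile> \<phi> \<Longrightarrow> \<Gamma> | H \<tturnstile> Forall A \<phi>"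
| forallE: "\<Gamma> | H \<tturnstile> Forall A \<phi> \<Longrightarrow> \<Gamma> \<turnstile> t : A \<Longrightarrow> \<Gamma> | H \<tturnstile> inst \<phi> t"
| existsI: "A # \<Gamma> \<turnstile> \<phi> : Omega \<Longrightarrow> \<Gamma> \<turnstile> t : A \<Longrightarrow> \<Gamma> | H \<tturnstile> inst \<phi> t \<Longrightarrow> \<Gamma> | H \<tturnstile> Exists A \<phi>"
| existsE: "\<Gamma> | H \<tturnstile> Exists A \<phi> \<Longrightarrow> A # \<Gamma> | \<phi> # map lift H \<tturnstile> lift \<psi> \<Longrightarrow> \<Gamma> | H \<tturnstile> \<psi>"
| eq_refl: "\<Gamma> \<turnstile> t : A \<Longrightarrow> \<Gamma> | H \<tturnstile> t \<^bold>= t"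
| eq_subst: "A # \<Gamma> \<turnstile> \<phi> : Omega \<Longrightarrow> \<Gamma> \<turnstile> s : A \<Longrightarrow> \<Gamma> \<turnstile> t : A \<Longrightarrow>
    \<Gamma> | H \<tturnstile> s \<^bold>= t \<Longrightarrow> \<Gamma> | H \<tturnstile> inst \<phi> s \<Longrightarrow> \<Gamma> | H \<tturnstile> inst \<phi> t"
| prop_ext: "\<Gamma> | H \<tturnstile> \<phi> \<^bold>\<longleftrightarrow> \<psi> \<Longrightarrow> \<Gamma> | H \<tturnstile> \<phi> \<^bold>= \<psi>"
| set_ext: "\<Gamma> \<turnstile> s : Power A \<Longrightarrow> \<Gamma> \<turnstile> t : Power A \<Longrightarrow>
    \<Gamma> | H \<tturnstile> Forall A (Var 0 \<^bold>\<in> lift s \<^bold>\<longleftrightarrow> Var 0 \<^bold>\<in> lift t) \<Longrightarrow> \<Gamma> | H \<tturnstile> s \<^bold>= t"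
| comprehension: "A # \<Gamma> \<turnstile> \<phi> : Omega \<Longrightarrow> \<Gamma> \<turnstile> t : A \<Longrightarrow>
    \<Gamma> | H \<tturnstile> t \<^bold>\<in> Compr A \<phi> \<^bold>\<longleftrightarrow> inst \<phi> t"
| unit_eq: "\<Gamma> \<turnstile> t : One \<Longrightarrow> \<Gamma> | H \<tturnstile> t \<^bold>= Star"
| tuple_eq1: "\<Gamma> | H \<tturnstile> Tuple s t \<^bold>= Tuple s' t' \<Longrightarrow> \<Gamma> | H \<tturnstile> s \<^bold>= s'"
| tuple_eq2: "\<Gamma> | H \<tturnstile> Tuple s t \<^bold>= Tuple s' t' \<Longrightarrow> \<Gamma> | H \<tturnstile> t \<^bold>= t'"
| tuple_surj: "\<Gamma> \<turnstile> t : Times A B \<Longrightarrow>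
    \<Gamma> | H \<tturnstile> Exists A (Exists B (lift (lift t) \<^bold>= Tuple (Var 1) (Var 0)))"

section \<open>Set-theoretic notions inside the type theory\<close>

text \<open>
  The type argument \<open>\<beta>\<close> is the type of the elements of the sets involved.
\<close>

definition empty_tm :: "'g ty \<Rightarrow> 'g tm" where
  "empty_tm \<beta> = Compr \<beta> \<^bold>\<bottom>"

definition singleton_tm :: "'g ty \<Rightarrow> 'g tm \<Rightarrow> 'g tm" where
  "singleton_tm \<beta> a = Compr \<beta> (Var 0 \<^bold>= lift a)"

definition union_tm :: "'g ty \<Rightarrow> 'g tm \<Rightarrow> 'g tm \<Rightarrow> 'g tm" where
  "union_tm \<beta> X Y = Compr \<beta> (Var 0 \<^bold>\<in> lift X \<^bold>\<or> Var 0 \<^bold>\<in> lift Y)"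

definition diff_tm :: "'g ty \<Rightarrow> 'g tm \<Rightarrow> 'g tm \<Rightarrow> 'g tm" where
  "diff_tm \<beta> X Y = Compr \<beta> (Var 0 \<^bold>\<in> lift X \<^bold>\<and> \<^bold>\<not> (Var 0 \<^bold>\<in> lift Y))"

definition subset_fm :: "'g ty \<Rightarrow> 'g tm \<Rightarrow> 'g tm \<Rightarrow> 'g tm" where
  "subset_fm \<beta> X Y = Forall \<beta> (Var 0 \<^bold>\<in> lift X \<^bold>\<longrightarrow> Var 0 \<^bold>\<in> lift Y)"

definition inhabited_fm :: "'g ty \<Rightarrow> 'g tm \<Rightarrow> 'g tm" where
  "inhabited_fm \<beta> X = Exists \<beta> (Var 0 \<^bold>\<in> lift X)"

definition proper_subset_fm :: "'g ty \<Rightarrow> 'g tm \<Rightarrow> 'g tm \<Rightarrow> 'g tm" where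
  "proper_subset_fm \<beta> A B = (subset_fm \<beta> A B \<^bold>\<and> inhabited_fm \<beta> (diff_tm \<beta> B A))"

definition complemented_fm :: "'g ty \<Rightarrow> 'g tm \<Rightarrow> 'g tm \<Rightarrow> 'g tm" where
  "complemented_fm \<beta> A B = (subset_fm \<beta> A B \<^bold>\<and> B \<^bold>= union_tm \<beta> A (diff_tm \<beta> B A))"

text \<open>
  Kuratowski finiteness.  In the closure condition the indices 2, 1, 0 stand for the family,
  a member \<open>Z\<close> of it, and an element \<open>a\<close> of \<open>A\<close>.
\<close>

definition finite_fm :: "'g ty \<Rightarrow> 'g tm \<Rightarrow> 'g tm" where
  "finite_fm \<beta> A =
    Forall (Power (Power \<beta>))
      (empty_tm \<beta> \<^bold>\<in> Var 0 \<^bold>\<and>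
       Forall (Power \<beta>) (Forall \<beta>
         (Var 1 \<^bold>\<in> Var 2 \<^bold>\<and> Var 0 \<^bold>\<in> lift (lift (lift A)) \<^bold>\<longrightarrow>
          union_tm \<beta> (Var 1) (singleton_tm \<beta> (Var 0)) \<^bold>\<in> Var 2))
       \<^bold>\<longrightarrow> lift A \<^bold>\<in> Var 0)"

text \<open>
  As usual in the internal logic of a topos, a function from \<open>A\<close> to \<open>B\<close> is given by its graph,
  here of type \<open>Power (Times \<beta> \<beta>)\<close>: it is contained in the product of \<open>A\<close> and \<open>B\<close>, total on \<open>A\<close>,
  and single-valued.
\<close>

definition function_fm :: "'g ty \<Rightarrow> 'g tm \<Rightarrow> 'g tm \<Rightarrow> 'g tm \<Rightarrow> 'g tm" where
  "function_fm \<beta> f A B =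
    (Forall \<beta> (Forall \<beta>
       (Tuple (Var 1) (Var 0) \<^bold>\<in> lift (lift f) \<^bold>\<longrightarrow>
        Var 1 \<^bold>\<in> lift (lift A) \<^bold>\<and> Var 0 \<^bold>\<in> lift (lift B))) \<^bold>\<and>
     Forall \<beta> (Var 0 \<^bold>\<in> lift A \<^bold>\<longrightarrow>
       Exists \<beta> (Tuple (Var 1) (Var 0) \<^bold>\<in> lift (lift f))) \<^bold>\<and>
     Forall \<beta> (Forall \<beta> (Forall \<beta>
       (Tuple (Var 2) (Var 1) \<^bold>\<in> lift (lift (lift f)) \<^bold>\<and>
        Tuple (Var 2) (Var 0) \<^bold>\<in> lift (lift (lift f)) \<^bold>\<longrightarrow> Var 1 \<^bold>= Var 0))))"

definition range_tm :: "'g ty \<Rightarrow> 'g tm \<Rightarrow> 'g tm" where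
  "range_tm \<beta> f = Compr \<beta> (Exists \<beta> (Tuple (Var 0) (Var 1) \<^bold>\<in> lift (lift f)))"

end

(*
  Write pre T for the preimage of T under f, defined on A only. Call T good if it is complemented
  in B and pre T is a proper subset of T, and call a in A settled at T if a in pre T implies
  a in pre (pre T). By Kuratowski induction on the set Z of elements to be settled, every good S
  contains a good T at which all elements of Z are settled: to add a, take such a T for Z; if
  a is in pre T but not in pre (pre T), which is decidable, then pre T is good again, and a is
  settled at every subset of pre T, so the induction hypothesis can be applied below pre T.
  Starting from S = B, which is good because pre B is contained in A, one gets a T at which all of
  A is settled. An element x of T outside pre T is then not in the range: if x = f a, then a is
  in pre T, hence in pre (pre T), so x = f a is in pre T.

  To carry this out inside the calculus, a pair of a context and a list of hypotheses is treated
  as a world of a Kripke model in which truth is derivability. Implication and universal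
  quantification are then introduced by passing to a later world, and disjunction and existence
  are eliminated in continuation style.
*)
theory Submission
  imports Defs
begin

section \<open>Substitution calculus\<close>

lemma up_ren_simps [simp]: "up_ren r 0 = 0" "up_ren r (Suc n) = Suc (r n)"
  by (simp_all add: up_ren_def)

lemma up_sub_simps [simp]: "up_sub \<sigma> 0 = Var 0" "up_sub \<sigma> (Suc n) = lift (\<sigma> n)"
  by (simp_all add: up_sub_def)

lemma up_ren_id [simp]: "up_ren (\<lambda>n. n) = (\<lambda>n. n)"
  by (rule ext) (simp add: up_ren_def split: nat.split)

lemma up_sub_Var [simp]: "up_sub Var = Var"
  by (rule ext) (simp add: up_sub_def split: nat.split)

lemma ren_id [simp]: "ren (\<lambda>n. n) t = t"
  by (induction t) simp_all

lemma sub_Var [simp]: "sub Var t = t"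
  by (induction t) simp_all

lemma up_ren_comp: "up_ren s \<circ> up_ren r = up_ren (s \<circ> r)"
  by (rule ext) (simp add: up_ren_def split: nat.split)

lemma ren_ren: "ren s (ren r t) = ren (s \<circ> r) t"
  by (induction t arbitrary: r s) (simp_all add: up_ren_comp)

lemma up_sub_comp_ren: "up_sub \<sigma> \<circ> up_ren r = up_sub (\<sigma> \<circ> r)"
  by (rule ext) (simp add: up_sub_def up_ren_def split: nat.split)

lemma sub_ren: "sub \<sigma> (ren r t) = sub (\<sigma> \<circ> r) t"
  by (induction t arbitrary: r \<sigma>) (simp_all add: up_sub_comp_ren)

lemma ren_up_lift [simp]: "ren (up_ren r) (lift t) = lift (ren r t)"
  by (simp add: ren_ren comp_def)

lemma ren_comp_up_sub: "ren (up_ren r) \<circ> up_sub \<sigma> = up_sub (ren r \<circ> \<sigma>)"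
  by (rule ext) (simp add: up_sub_def split: nat.split)

lemma ren_sub: "ren r (sub \<sigma> t) = sub (ren r \<circ> \<sigma>) t"
  by (induction t arbitrary: r \<sigma>) (simp_all add: ren_comp_up_sub)

text \<open>The set-theoretic notions lift their arguments under binders. This rule pushes a
  substitution through those lifts, and \<open>sub_inst_lift\<close> cancels the last one when the
  bound variable is instantiated.\<close>

lemma sub_up_lift [simp]: "sub (up_sub \<sigma>) (lift t) = lift (sub \<sigma> t)"
  by (simp add: sub_ren ren_sub comp_def)

lemma sub_inst_lift [simp]: "sub (case_nat u Var) (lift t) = t"
  by (simp add: sub_ren comp_def)

text \<open>Both sides send index 0 to \<open>ren r t\<close> and index \<open>Suc n\<close> to
  \<open>Var (r n)\<close>. It makes the rules that mention \<open>inst\<close> stable under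
  renaming.\<close>

lemma ren_inst: "ren r (inst \<phi> t) = inst (ren (up_ren r) \<phi>) (ren r t)"
proof -
  have "ren r \<circ> case_nat t Var = case_nat (ren r t) Var \<circ> up_ren r"
    by (rule ext) (simp split: nat.split)
  then show ?thesis
    by (simp add: inst_def ren_sub sub_ren)
qed

text \<open>Only indices below the length of the context matter for a typed term. Plain equality of
  functions would be too strong for \<open>last_to_front\<close>, which equals \<open>Suc\<close> on
  those indices only.\<close>

definition sub_agree :: "'g ty list \<Rightarrow> (nat \<Rightarrow> 'g tm) \<Rightarrow> (nat \<Rightarrow> 'g tm) \<Rightarrow> bool" where
  "sub_agree \<Gamma> \<sigma> \<tau> \<longleftrightarrow> (\<forall>n < length \<Gamma>. \<sigma> n = \<tau> n)"

lemma sub_agree_up: "sub_agree \<Gamma> \<sigma> \<tau> \<Longrightarrow> sub_agree (A # \<Gamma>) (up_sub \<sigma>) (up_sub \<tau>)"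
  by (auto simp: sub_agree_def up_sub_def split: nat.split)

lemma sub_cong_typed: "\<Gamma> \<turnstile> t : A \<Longrightarrow> sub_agree \<Gamma> \<sigma> \<tau> \<Longrightarrow> sub \<sigma> t = sub \<tau> t"
proof (induction arbitrary: \<sigma> \<tau> rule: has_type.induct)
  case (1 n \<Gamma>)
  then show ?case by (simp add: sub_agree_def)
qed (simp; blast intro: sub_agree_up)+

lemma up_sub_of_ren: "up_sub (\<lambda>n. Var (r n)) = (\<lambda>n. Var (up_ren r n))"
  by (rule ext) (simp add: up_sub_def up_ren_def split: nat.split)

text \<open>Transfers facts about substitutions, in particular the congruence on typed terms, to
  renamings.\<close>

lemma ren_as_sub: "ren r t = sub (\<lambda>n. Var (r n)) t"
  by (induction t arbitrary: r) (simp_all add: up_sub_of_ren)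

lemma ren_cong_typed:
  "\<Gamma> \<turnstile> t : A \<Longrightarrow> (\<And>n. n < length \<Gamma> \<Longrightarrow> r n = s n) \<Longrightarrow> ren r t = ren s t"
  unfolding ren_as_sub by (erule sub_cong_typed) (simp add: sub_agree_def)

section \<open>Typing\<close>

definition ren_ok :: "(nat \<Rightarrow> nat) \<Rightarrow> 'g ty list \<Rightarrow> 'g ty list \<Rightarrow> bool" where
  "ren_ok r \<Gamma> \<Delta> \<longleftrightarrow> (\<forall>n < length \<Gamma>. r n < length \<Delta> \<and> \<Delta> ! r n = \<Gamma> ! n)"

lemma ren_ok_up: "ren_ok r \<Gamma> \<Delta> \<Longrightarrow> ren_ok (up_ren r) (A # \<Gamma>) (A # \<Delta>)"
  by (auto simp: ren_ok_def up_ren_def split: nat.split)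

lemma ren_typed: "\<Gamma> \<turnstile> t : A \<Longrightarrow> ren_ok r \<Gamma> \<Delta> \<Longrightarrow> \<Delta> \<turnstile> ren r t : A"
proof (induction arbitrary: r \<Delta> rule: has_type.induct)
  case (1 n \<Gamma>)
  then show ?case
    using has_type.intros(1)[of "r n" \<Delta>] by (simp add: ren_ok_def)
qed (simp; blast intro: has_type.intros ren_ok_up)+

lemma lift_typed: "\<Gamma> \<turnstile> t : A \<Longrightarrow> B # \<Gamma> \<turnstile> lift t : A"
  by (erule ren_typed) (simp add: ren_ok_def)

lemma typed_append: "\<Gamma> \<turnstile> t : A \<Longrightarrow> \<Gamma> @ \<Delta> \<turnstile> t : A"
  using ren_typed[of \<Gamma> t A "\<lambda>n. n" "\<Gamma> @ \<Delta>"] by (simp add: ren_ok_def nth_append)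

lemma Var_typed: "n < length \<Gamma> \<Longrightarrow> \<Gamma> ! n = A \<Longrightarrow> \<Gamma> \<turnstile> Var n : A"
  using has_type.intros(1) by blast

definition sub_ok :: "(nat \<Rightarrow> 'g tm) \<Rightarrow> 'g ty list \<Rightarrow> 'g ty list \<Rightarrow> bool" where
  "sub_ok \<sigma> \<Gamma> \<Delta> \<longleftrightarrow> (\<forall>n < length \<Gamma>. \<Delta> \<turnstile> \<sigma> n : \<Gamma> ! n)"

lemma sub_ok_up: "sub_ok \<sigma> \<Gamma> \<Delta> \<Longrightarrow> sub_ok (up_sub \<sigma>) (A # \<Gamma>) (A # \<Delta>)"
  by (auto simp: sub_ok_def up_sub_def intro: Var_typed lift_typed split: nat.split)

lemma sub_typed: "\<Gamma> \<turnstile> t : A \<Longrightarrow> sub_ok \<sigma> \<Gamma> \<Delta> \<Longrightarrow> \<Delta> \<turnstile> sub \<sigma> t : A"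
proof (induction arbitrary: \<sigma> \<Delta> rule: has_type.induct)
  case (1 n \<Gamma>)
  then show ?case by (simp add: sub_ok_def)
qed (simp; blast intro: has_type.intros sub_ok_up)+

lemma inst_typed: "A # \<Gamma> \<turnstile> \<phi> : B \<Longrightarrow> \<Gamma> \<turnstile> t : A \<Longrightarrow> \<Gamma> \<turnstile> inst \<phi> t : B"
  unfolding inst_def
  by (erule sub_typed) (auto simp: sub_ok_def intro: Var_typed split: nat.split)

\<comment> \<open>Typing is syntax directed, so every rule can be read backwards as an equivalence.
  Rewriting with these settles most typing goals; what remains is an existential element type for
  membership and equality.\<close>
inductive_simps typed_simps:
  "\<Gamma> \<turnstile> Var n : A"
  "\<Gamma> \<turnstile> Star : A"
  "\<Gamma> \<turnstile> Tuple s t : A"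
  "\<Gamma> \<turnstile> Compr B \<phi> : A"
  "\<Gamma> \<turnstile> (s \<^bold>\<in> t) : A"
  "\<Gamma> \<turnstile> (s \<^bold>= t) : A"
  "\<Gamma> \<turnstile> \<^bold>\<bottom> : A"
  "\<Gamma> \<turnstile> (\<phi> \<^bold>\<and> \<psi>) : A"
  "\<Gamma> \<turnstile> (\<phi> \<^bold>\<or> \<psi>) : A"
  "\<Gamma> \<turnstile> (\<phi> \<^bold>\<longrightarrow> \<psi>) : A"
  "\<Gamma> \<turnstile> Forall B \<phi> : A"
  "\<Gamma> \<turnstile> Exists B \<phi> : A"

text \<open>The opposite direction to \<open>ren_ok\<close>: an index landing in \<Delta> must come
  from \<Gamma>. \<open>Suc\<close> has this property when one type is put in front, so a lift can
  be stripped from a typing judgement.\<close>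

definition ren_reflects :: "(nat \<Rightarrow> nat) \<Rightarrow> 'g ty list \<Rightarrow> 'g ty list \<Rightarrow> bool" where
  "ren_reflects r \<Gamma> \<Delta> \<longleftrightarrow> (\<forall>n. r n < length \<Delta> \<longrightarrow> n < length \<Gamma> \<and> \<Gamma> ! n = \<Delta> ! r n)"

lemma ren_reflects_up: "ren_reflects r \<Gamma> \<Delta> \<Longrightarrow> ren_reflects (up_ren r) (A # \<Gamma>) (A # \<Delta>)"
  by (auto simp: ren_reflects_def up_ren_def split: nat.splits)

lemma ren_typed_rev: "\<Delta> \<turnstile> ren r t : A \<Longrightarrow> ren_reflects r \<Gamma> \<Delta> \<Longrightarrow> \<Gamma> \<turnstile> t : A"
proof (induction t arbitrary: r \<Gamma> \<Delta> A)
  case (Var n)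
  then show ?case by (simp add: typed_simps ren_reflects_def)
qed (simp add: typed_simps; blast intro: ren_reflects_up)+

lemma Iff_typed: "\<Gamma> \<turnstile> (\<phi> \<^bold>\<longleftrightarrow> \<psi>) : A \<longleftrightarrow> A = Omega \<and> \<Gamma> \<turnstile> \<phi> : Omega \<and> \<Gamma> \<turnstile> \<psi> : Omega"
  by (auto simp: Iff_def typed_simps)

lemma Neg_typed: "\<Gamma> \<turnstile> \<^bold>\<not> \<phi> : A \<longleftrightarrow> A = Omega \<and> \<Gamma> \<turnstile> \<phi> : Omega"
  by (auto simp: Neg_def typed_simps)

text \<open>The rule \<open>hyp\<close> has no typing premise, so typing must start from the
  hypotheses. It carries over to the enlarged lists of hypotheses in \<open>disjE\<close>,
  \<open>impI\<close> and \<open>existsE\<close>.\<close>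

lemma derivable_typed:
  "\<Gamma> | H \<tturnstile> \<phi> \<Longrightarrow> (\<And>h. h \<in> set H \<Longrightarrow> \<Gamma> \<turnstile> h : Omega) \<Longrightarrow> \<Gamma> \<turnstile> \<phi> : Omega"
proof (induction rule: derivable.induct)
  case (disjE \<Gamma> H \<phi> \<psi> \<chi>)
  then show ?case by (auto simp: typed_simps)
next
  case (forallI A \<Gamma> H \<phi>)
  then show ?case by (auto simp: typed_simps intro: lift_typed)
next
  case (existsE \<Gamma> H A \<phi> \<psi>)
  \<comment> \<open>The induction hypothesis types the conclusion only under the extra variable;
    reflecting along \<open>Suc\<close> brings it back to \<Gamma>.\<close>
  then have "A # \<Gamma> \<turnstile> lift \<psi> : Omega"
    by (auto simp: typed_simps intro: lift_typed)
  then show ?case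
    by (rule ren_typed_rev) (simp add: ren_reflects_def)
next
  case (tuple_surj \<Gamma> t A B H)
  then show ?case
    by (auto simp: typed_simps intro!: lift_typed)
qed (auto simp: typed_simps Iff_typed intro: inst_typed)

text \<open>Weakening and change of variables in one induction. \<open>r\<close>, \<Delta> and
  \<open>K\<close> vary because binders turn \<open>r\<close> into \<open>up_ren r\<close> and
  discharging rules extend \<open>K\<close>. The identity renaming will give persistence of truth,
  and \<open>last_to_front\<close> the quantifier rules.\<close>

lemma derivable_ren:
  "\<Gamma> | H \<tturnstile> \<phi> \<Longrightarrow> ren_ok r \<Gamma> \<Delta> \<Longrightarrow> ren r ` set H \<subseteq> set K \<Longrightarrow> \<Delta> | K \<tturnstile> ren r \<phi>"
proof (induction arbitrary: r \<Delta> K rule: derivable.induct)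
  case (disjE \<Gamma> H \<phi> \<psi> \<chi>)
  show ?case
    by (rule derivable.disjE[of _ _ "ren r \<phi>" "ren r \<psi>"]; (rule disjE.IH)?)
      (use disjE.IH(1) disjE.prems in auto)
next
  case (impI \<Gamma> \<phi> H \<psi>)
  then have "\<Delta> | ren r \<phi> # K \<tturnstile> ren r \<psi>"
    by (intro impI.IH) auto
  with impI show ?case
    by (auto intro: derivable.impI ren_typed)
next
  case (forallI A \<Gamma> H \<phi>)
  then have "A # \<Delta> | map lift K \<tturnstile> ren (up_ren r) \<phi>"
    by (intro forallI.IH) (auto intro: ren_ok_up)
  then show ?case by (auto intro: derivable.forallI)
next
  case (existsI A \<Gamma> \<phi> t H)
  then show ?case
    by (auto simp: ren_inst intro!: derivable.existsI[of _ _ _ "ren r t"] intro: ren_typed ren_ok_up)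
next
  case (existsE \<Gamma> H A \<phi> \<psi>)
  have "A # \<Delta> | ren (up_ren r) \<phi> # map lift K \<tturnstile> ren (up_ren r) (lift \<psi>)"
    using existsE.prems by (intro existsE.IH(2)) (auto intro: ren_ok_up)
  with existsE.IH(1)[OF existsE.prems] show ?case
    by (auto intro: derivable.existsE)
next
  case (eq_subst A \<Gamma> \<phi> s t H)
  then show ?case
    using derivable.eq_subst[of A \<Delta> "ren (up_ren r) \<phi>" "ren r s" "ren r t" K]
    by (simp add: ren_inst ren_typed ren_ok_up)
next
  case (set_ext \<Gamma> s A t H)
  then show ?case
    by (auto simp: Iff_def intro!: derivable.set_ext intro: ren_typed)
next
  case (comprehension A \<Gamma> \<phi> t H)
  then show ?case
    using derivable.comprehension[of A \<Delta> "ren (up_ren r) \<phi>" "ren r t" K]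
    by (simp add: Iff_def ren_inst ren_typed ren_ok_up)
next
  case (tuple_surj \<Gamma> t A B H)
  then show ?case
    using derivable.tuple_surj[of \<Delta> "ren r t" A B K] by (simp add: ren_typed numeral_eq_Suc)
next
  case (forallE \<Gamma> H A \<phi> t)
  then show ?case
    using derivable.forallE[of \<Delta> K A "ren (up_ren r) \<phi>" "ren r t"] by (simp add: ren_inst ren_typed)
next
  case (hyp \<phi> H \<Gamma>)
  then show ?case by (auto intro: derivable.hyp)
next
  case (prop_ext \<Gamma> H \<phi> \<psi>)
  then show ?case by (simp add: Iff_def derivable.prop_ext)
next
  case (falsumE \<Gamma> H \<phi>)
  then show ?case by (auto intro: derivable.falsumE ren_typed)
next
  case (conjI \<Gamma> H \<phi> \<psi>)
  then show ?case by (simp add: derivable.conjI)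
next
  case (conjE1 \<Gamma> H \<phi> \<psi>)
  from conjE1.IH[OF conjE1.prems] show ?case by (auto intro: derivable.conjE1)
next
  case (conjE2 \<Gamma> H \<phi> \<psi>)
  from conjE2.IH[OF conjE2.prems] show ?case by (auto intro: derivable.conjE2)
next
  case (disjI1 \<Gamma> H \<phi> \<psi>)
  then show ?case by (simp add: derivable.disjI1 ren_typed)
next
  case (disjI2 \<Gamma> H \<psi> \<phi>)
  then show ?case by (simp add: derivable.disjI2 ren_typed)
next
  case (impE \<Gamma> H \<phi> \<psi>)
  from impE.IH(1)[OF impE.prems] impE.IH(2)[OF impE.prems] show ?case
    by (auto intro: derivable.impE)
next
  case (eq_refl \<Gamma> t A H)
  then show ?case by (auto intro: derivable.eq_refl ren_typed)
next
  case (unit_eq \<Gamma> t H)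
  then show ?case by (auto intro: derivable.unit_eq ren_typed)
next
  case (tuple_eq1 \<Gamma> H s t s' t')
  from tuple_eq1.IH[OF tuple_eq1.prems] show ?case by (auto intro: derivable.tuple_eq1)
next
  case (tuple_eq2 \<Gamma> H s t s' t')
  from tuple_eq2.IH[OF tuple_eq2.prems] show ?case by (auto intro: derivable.tuple_eq2)
qed

text \<open>\<open>Compr\<close> records the type of its bound variable, so no type has to be
  guessed. Uniqueness later recovers the type of an element from that of a set containing
  it.\<close>

lemma type_unique: "\<Gamma> \<turnstile> t : A \<Longrightarrow> \<Gamma> \<turnstile> t : B \<Longrightarrow> A = B"
proof (induction arbitrary: B rule: has_type.induct)
  case (3 \<Gamma> s A t C)
  from 3(5) obtain A' C' where "B = Times A' C'" "\<Gamma> \<turnstile> s : A'" "\<Gamma> \<turnstile> t : C'"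
    unfolding typed_simps by blast
  with 3(3,4) show ?case by blast
qed (unfold typed_simps, blast+)

lemma lift_typed_iff [simp]: "B # \<Gamma> \<turnstile> lift t : A \<longleftrightarrow> \<Gamma> \<turnstile> t : A"
  by (auto intro: lift_typed ren_typed_rev simp: ren_reflects_def)

declare typed_simps [simp] Iff_typed [simp] Neg_typed [simp]

section \<open>Kripke-style reasoning about derivability\<close>

text \<open>With the typing of the hypotheses built into the type of worlds, every formula true at a
  world is well typed without a side condition.\<close>

typedef 'g world = "{(\<Gamma>, H). \<forall>h \<in> set H. \<Gamma> \<turnstile> h : (Omega :: 'g ty)}"
  by (rule exI[of _ "([], [])"]) simp

definition ctx :: "'g world \<Rightarrow> 'g ty list" where
  "ctx w = fst (Rep_world w)"

definition hyps :: "'g world \<Rightarrow> 'g tm list" where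
  "hyps w = snd (Rep_world w)"

definition holds :: "'g world \<Rightarrow> 'g tm \<Rightarrow> bool"  (infix "\<Vdash>" 50) where
  "w \<Vdash> \<phi> \<longleftrightarrow> ctx w | hyps w \<tturnstile> \<phi>"

text \<open>
  New variables are appended at the end of the context, so that a term
  keeps its de Bruijn indices when it is moved to a later world.
\<close>

definition extends :: "'g world \<Rightarrow> 'g world \<Rightarrow> bool"  (infix "\<preceq>" 50) where
  "w \<preceq> v \<longleftrightarrow> (\<exists>\<Delta>. ctx v = ctx w @ \<Delta>) \<and> set (hyps w) \<subseteq> set (hyps v)"

lemma extends_refl [simp]: "w \<preceq> w"
  by (simp add: extends_def)

lemma extends_trans: "u \<preceq> v \<Longrightarrow> v \<preceq> w \<Longrightarrow> u \<preceq> w"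
  by (auto simp: extends_def)

lemma hyps_typed: "h \<in> set (hyps w) \<Longrightarrow> ctx w \<turnstile> h : Omega"
  using Rep_world[of w] by (auto simp: ctx_def hyps_def)

lemma world_exists:
  assumes "\<And>h. h \<in> set H \<Longrightarrow> \<Gamma> \<turnstile> h : Omega"
  obtains w where "ctx w = \<Gamma>" "hyps w = H"
  using assms Abs_world_inverse[of "(\<Gamma>, H)"] that[of "Abs_world (\<Gamma>, H)"]
  by (simp add: ctx_def hyps_def)

lemma typed_mono: "ctx w \<turnstile> t : A \<Longrightarrow> w \<preceq> v \<Longrightarrow> ctx v \<turnstile> t : A"
  by (auto simp: extends_def typed_append)

text \<open>Persistence of truth: later worlds append variables and add hypotheses, so the identity
  renaming transports the derivation.\<close>

lemma holds_mono: "w \<Vdash> \<phi> \<Longrightarrow> w \<preceq> v \<Longrightarrow> v \<Vdash> \<phi>"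
  using derivable_ren[of "ctx w" "hyps w" \<phi> "\<lambda>n. n" "ctx v" "hyps v"]
  by (auto simp: holds_def extends_def ren_ok_def nth_append)

lemma holds_typed: "w \<Vdash> \<phi> \<Longrightarrow> ctx w \<turnstile> \<phi> : Omega"
  by (auto simp: holds_def intro: derivable_typed hyps_typed)

text \<open>The generic later world at which \<phi> is true. A claim about all later worlds is
  tested on this one to obtain the rules that discharge a hypothesis.\<close>

lemma extend_hyp:
  assumes "ctx w \<turnstile> \<phi> : Omega"
  obtains v where "w \<preceq> v" "ctx v = ctx w" "hyps v = \<phi> # hyps w" "v \<Vdash> \<phi>"
proof -
  obtain v where "ctx v = ctx w" "hyps v = \<phi> # hyps w"
    using world_exists[of "\<phi> # hyps w" "ctx w"] assms hyps_typed by auto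
  then show thesis
    by (intro that[of v]) (auto simp: extends_def holds_def intro: hyp)
qed

text \<open>The appended variable plays the role of a generic element of type
  \<open>A\<close>.\<close>

lemma extend_var:
  obtains v where "w \<preceq> v" "ctx v = ctx w @ [A]" "hyps v = hyps w"
proof -
  obtain v where "ctx v = ctx w @ [A]" "hyps v = hyps w"
    using world_exists[of "hyps w" "ctx w @ [A]"] hyps_typed typed_append by blast
  then show thesis
    using that[of v] by (auto simp: extends_def)
qed

text \<open>Worlds append a fresh variable at the end, while the quantifier rules of the calculus
  expect it at index 0. This renaming mediates: with \<open>n\<close> the length of the old context,
  old variables move up by one and the appended one becomes 0.\<close>

definition last_to_front :: "nat \<Rightarrow> nat \<Rightarrow> nat" where
  "last_to_front n = (\<lambda>i. if i < n then Suc i else 0)"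

lemma ren_ok_last_to_front: "ren_ok (last_to_front (length \<Gamma>)) (\<Gamma> @ [A]) (A # \<Gamma>)"
  by (auto simp: ren_ok_def last_to_front_def nth_append)

lemma ren_last_to_front: "\<Gamma> \<turnstile> t : A \<Longrightarrow> ren (last_to_front (length \<Gamma>)) t = lift t"
  by (erule ren_cong_typed) (simp add: last_to_front_def)

lemma map_ren_last_to_front:
  "(\<And>h. h \<in> set H \<Longrightarrow> \<Gamma> \<turnstile> h : Omega) \<Longrightarrow> ren (last_to_front (length \<Gamma>)) ` set H = set (map lift H)"
  by (force simp: ren_last_to_front)

text \<open>Index 0 goes to the appended variable and back to 0, index \<open>Suc n\<close> goes to
  \<open>n\<close> and back to \<open>Suc n\<close>, so the composite is the identity on the context
  of \<phi>.\<close>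

lemma ren_last_to_front_inst:
  assumes "A # \<Gamma> \<turnstile> \<phi> : B"
  shows "ren (last_to_front (length \<Gamma>)) (inst \<phi> (Var (length \<Gamma>))) = \<phi>"
proof -
  have "sub_agree (A # \<Gamma>)
      (ren (last_to_front (length \<Gamma>)) \<circ> case_nat (Var (length \<Gamma>)) Var) Var"
    by (auto simp: sub_agree_def last_to_front_def split: nat.split)
  from sub_cong_typed[OF assms this] show ?thesis
    by (simp add: inst_def ren_sub)
qed

section \<open>Natural deduction at worlds\<close>

lemma holds_conj [simp]: "w \<Vdash> \<phi> \<^bold>\<and> \<psi> \<longleftrightarrow> w \<Vdash> \<phi> \<and> w \<Vdash> \<psi>"
  unfolding holds_def by (metis conjI conjE1 conjE2)

lemma holds_disjI1: "w \<Vdash> \<phi> \<Longrightarrow> ctx w \<turnstile> \<psi> : Omega \<Longrightarrow> w \<Vdash> \<phi> \<^bold>\<or> \<psi>"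
  by (simp add: holds_def disjI1)

lemma holds_disjI2: "w \<Vdash> \<psi> \<Longrightarrow> ctx w \<turnstile> \<phi> : Omega \<Longrightarrow> w \<Vdash> \<phi> \<^bold>\<or> \<psi>"
  by (simp add: holds_def disjI2)

lemma holds_falsumE: "w \<Vdash> \<^bold>\<bottom> \<Longrightarrow> ctx w \<turnstile> \<phi> : Omega \<Longrightarrow> w \<Vdash> \<phi>"
  by (simp add: holds_def falsumE)

text \<open>Each case is used at one world only, the one that adds the disjunct as a hypothesis.
  Since the context stays the same, these are exactly the premises of \<open>disjE\<close>.\<close>

lemma holds_disjE:
  assumes "w \<Vdash> \<phi> \<^bold>\<or> \<psi>"
    and "\<And>v. w \<preceq> v \<Longrightarrow> v \<Vdash> \<phi> \<Longrightarrow> v \<Vdash> \<chi>"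
    and "\<And>v. w \<preceq> v \<Longrightarrow> v \<Vdash> \<psi> \<Longrightarrow> v \<Vdash> \<chi>"
  shows "w \<Vdash> \<chi>"
proof -
  from holds_typed[OF assms(1)] have t: "ctx w \<turnstile> \<phi> : Omega" "ctx w \<turnstile> \<psi> : Omega"
    by simp_all
  obtain v where "w \<preceq> v" "ctx v = ctx w" "hyps v = \<phi> # hyps w" "v \<Vdash> \<phi>"
    by (rule extend_hyp[OF t(1)])
  then have 1: "ctx w | \<phi> # hyps w \<tturnstile> \<chi>"
    using assms(2)[of v] by (simp add: holds_def)
  obtain v where "w \<preceq> v" "ctx v = ctx w" "hyps v = \<psi> # hyps w" "v \<Vdash> \<psi>"
    by (rule extend_hyp[OF t(2)])
  then have "ctx w | \<psi> # hyps w \<tturnstile> \<chi>"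
    using assms(3)[of v] by (simp add: holds_def)
  with 1 assms(1) show ?thesis
    unfolding holds_def by (metis disjE)
qed

lemma holds_impI:
  assumes "ctx w \<turnstile> \<phi> : Omega" and "\<And>v. w \<preceq> v \<Longrightarrow> v \<Vdash> \<phi> \<Longrightarrow> v \<Vdash> \<psi>"
  shows "w \<Vdash> \<phi> \<^bold>\<longrightarrow> \<psi>"
proof -
  obtain v where "w \<preceq> v" "ctx v = ctx w" "hyps v = \<phi> # hyps w" "v \<Vdash> \<phi>"
    by (rule extend_hyp[OF assms(1)])
  then show ?thesis
    using assms(1) assms(2)[of v] by (simp add: holds_def impI)
qed

lemma holds_impE: "w \<Vdash> \<phi> \<^bold>\<longrightarrow> \<psi> \<Longrightarrow> w \<Vdash> \<phi> \<Longrightarrow> w \<Vdash> \<psi>"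
  unfolding holds_def by (rule impE)

lemma holds_negI:
  "ctx w \<turnstile> \<phi> : Omega \<Longrightarrow> (\<And>v. w \<preceq> v \<Longrightarrow> v \<Vdash> \<phi> \<Longrightarrow> v \<Vdash> \<^bold>\<bottom>) \<Longrightarrow> w \<Vdash> \<^bold>\<not> \<phi>"
  unfolding Neg_def by (rule holds_impI)

lemma holds_negE: "w \<Vdash> \<^bold>\<not> \<phi> \<Longrightarrow> w \<Vdash> \<phi> \<Longrightarrow> ctx w \<turnstile> \<psi> : Omega \<Longrightarrow> w \<Vdash> \<psi>"
  unfolding Neg_def by (rule holds_falsumE[OF holds_impE])

text \<open>The second premise is applied to the appended variable. Moving this variable to the
  front turns the instance back into \<phi>, which is what \<open>forallI\<close> asks for.\<close>

lemma holds_forallI: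
  assumes "A # ctx w \<turnstile> \<phi> : Omega"
    and "\<And>v t. w \<preceq> v \<Longrightarrow> ctx v \<turnstile> t : A \<Longrightarrow> v \<Vdash> inst \<phi> t"
  shows "w \<Vdash> Forall A \<phi>"
proof -
  let ?r = "last_to_front (length (ctx w))"
  obtain v where v: "w \<preceq> v" "ctx v = ctx w @ [A]" "hyps v = hyps w"
    by (rule extend_var)
  then have "ctx w @ [A] | hyps w \<tturnstile> inst \<phi> (Var (length (ctx w)))"
    using assms(2)[of v "Var (length (ctx w))"] by (simp add: holds_def)
  then have "A # ctx w | map lift (hyps w) \<tturnstile> ren ?r (inst \<phi> (Var (length (ctx w))))"
    by (rule derivable_ren) (simp_all add: ren_ok_last_to_front map_ren_last_to_front hyps_typed)
  with assms(1) show ?thesis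
    by (simp add: holds_def ren_last_to_front_inst forallI)
qed

lemma holds_forallE: "w \<Vdash> Forall A \<phi> \<Longrightarrow> ctx w \<turnstile> t : A \<Longrightarrow> w \<Vdash> inst \<phi> t"
  by (simp add: holds_def forallE)

lemma holds_existsI:
  "w \<Vdash> inst \<phi> t \<Longrightarrow> ctx w \<turnstile> t : A \<Longrightarrow> A # ctx w \<turnstile> \<phi> : Omega \<Longrightarrow> w \<Vdash> Exists A \<phi>"
  unfolding holds_def by (rule existsI)

text \<open>The world is extended twice: by a generic element, then by the hypothesis that it
  satisfies \<phi>. As \<psi> is typed before the extension, moving the new variable to the front
  merely lifts it, as \<open>existsE\<close> requires.\<close>

lemma holds_existsE:
  assumes "w \<Vdash> Exists A \<phi>" and "ctx w \<turnstile> \<psi> : Omega"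
    and "\<And>v t. w \<preceq> v \<Longrightarrow> ctx v \<turnstile> t : A \<Longrightarrow> v \<Vdash> inst \<phi> t \<Longrightarrow> v \<Vdash> \<psi>"
  shows "w \<Vdash> \<psi>"
proof -
  let ?r = "last_to_front (length (ctx w))" and ?x = "Var (length (ctx w))"
  have \<phi>: "A # ctx w \<turnstile> \<phi> : Omega"
    using holds_typed[OF assms(1)] by simp
  obtain u where u: "w \<preceq> u" "ctx u = ctx w @ [A]" "hyps u = hyps w"
    by (rule extend_var)
  have x: "ctx u \<turnstile> ?x : A"
    by (simp add: u)
  have "A # ctx u \<turnstile> \<phi> : Omega"
    using typed_append[OF \<phi>, of "[A]"] by (simp add: u)
  then have "ctx u \<turnstile> inst \<phi> ?x : Omega"
    using x by (rule inst_typed)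
  then obtain v where v: "u \<preceq> v" "ctx v = ctx u" "hyps v = inst \<phi> ?x # hyps u" "v \<Vdash> inst \<phi> ?x"
    by (rule extend_hyp)
  have "v \<Vdash> \<psi>"
    using assms(3)[of v ?x] extends_trans[OF u(1) v(1)] v x by simp
  then have "ctx w @ [A] | inst \<phi> ?x # hyps w \<tturnstile> \<psi>"
    by (simp add: holds_def u v)
  then have "A # ctx w | \<phi> # map lift (hyps w) \<tturnstile> ren ?r \<psi>"
    by (rule derivable_ren)
      (simp_all add: ren_ok_last_to_front map_ren_last_to_front hyps_typed
        ren_last_to_front_inst[OF \<phi>] subset_insertI)
  with assms(1) show ?thesis
    unfolding holds_def ren_last_to_front[OF assms(2)] by (rule existsE)
qed

section \<open>Equality, extensionality and comprehension\<close>

lemma holds_eq_subst: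
  assumes "w \<Vdash> s \<^bold>= t" "w \<Vdash> inst \<phi> s" "ctx w \<turnstile> s : A" "A # ctx w \<turnstile> \<phi> : Omega"
  shows "w \<Vdash> inst \<phi> t"
proof -
  have "ctx w \<turnstile> t : A"
    using holds_typed[OF assms(1)] assms(3) by (auto dest: type_unique)
  with assms show ?thesis
    unfolding holds_def by (metis eq_subst)
qed

text \<open>Leibniz substitution in the formula "index 0 equals \<open>s\<close>", starting from
  reflexivity of \<open>s\<close>.\<close>

lemma holds_eq_sym:
  assumes "w \<Vdash> s \<^bold>= t"
  shows "w \<Vdash> t \<^bold>= s"
proof -
  obtain A where "ctx w \<turnstile> s : A"
    using holds_typed[OF assms] by auto
  moreover from this have "w \<Vdash> s \<^bold>= s"
    by (auto simp: holds_def intro: eq_refl)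
  ultimately show ?thesis
    using holds_eq_subst[of w s t "Var 0 \<^bold>= lift s" A] assms by (simp add: inst_def)
qed

lemma holds_eq_mem:
  assumes "w \<Vdash> s \<^bold>= t" "w \<Vdash> s \<^bold>\<in> X"
  shows "w \<Vdash> t \<^bold>\<in> X"
proof -
  obtain A where "ctx w \<turnstile> s : A" "ctx w \<turnstile> X : Power A"
    using holds_typed[OF assms(2)] by auto
  then show ?thesis
    using holds_eq_subst[of w s t "Var 0 \<^bold>\<in> lift X" A] assms by (simp add: inst_def)
qed

lemma holds_mem_eq:
  assumes "w \<Vdash> X \<^bold>= Y" "w \<Vdash> s \<^bold>\<in> X"
  shows "w \<Vdash> s \<^bold>\<in> Y"
proof -
  obtain A where "ctx w \<turnstile> s : A" "ctx w \<turnstile> X : Power A"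
    using holds_typed[OF assms(2)] by auto
  then show ?thesis
    using holds_eq_subst[of w X Y "lift s \<^bold>\<in> Var 0" "Power A"] assms
    by (simp add: inst_def)
qed

lemma holds_set_eqI:
  assumes "ctx w \<turnstile> X : Power A" "ctx w \<turnstile> Y : Power A"
    and "\<And>v x. w \<preceq> v \<Longrightarrow> ctx v \<turnstile> x : A \<Longrightarrow> v \<Vdash> x \<^bold>\<in> X \<Longrightarrow> v \<Vdash> x \<^bold>\<in> Y"
    and "\<And>v x. w \<preceq> v \<Longrightarrow> ctx v \<turnstile> x : A \<Longrightarrow> v \<Vdash> x \<^bold>\<in> Y \<Longrightarrow> v \<Vdash> x \<^bold>\<in> X"
  shows "w \<Vdash> X \<^bold>= Y"
proof -
  have "w \<Vdash> Forall A (Var 0 \<^bold>\<in> lift X \<^bold>\<longleftrightarrow> Var 0 \<^bold>\<in> lift Y)"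
  proof (rule holds_forallI)
    fix v x
    assume v: "w \<preceq> v" and x: "ctx v \<turnstile> x : A"
    note XY = assms(1,2)[THEN typed_mono, OF v]
    have "v \<Vdash> x \<^bold>\<in> X \<^bold>\<longrightarrow> x \<^bold>\<in> Y"
    proof (rule holds_impI)
      fix u assume "v \<preceq> u" "u \<Vdash> x \<^bold>\<in> X"
      then show "u \<Vdash> x \<^bold>\<in> Y"
        using assms(3)[OF extends_trans[OF v] typed_mono[OF x]] by blast
    qed (use x XY in auto)
    moreover have "v \<Vdash> x \<^bold>\<in> Y \<^bold>\<longrightarrow> x \<^bold>\<in> X"
    proof (rule holds_impI)
      fix u assume "v \<preceq> u" "u \<Vdash> x \<^bold>\<in> Y"
      then show "u \<Vdash> x \<^bold>\<in> X"
        using assms(4)[OF extends_trans[OF v] typed_mono[OF x]] by blast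
    qed (use x XY in auto)
    ultimately show "v \<Vdash> inst (Var 0 \<^bold>\<in> lift X \<^bold>\<longleftrightarrow> Var 0 \<^bold>\<in> lift Y) x"
      by (simp add: inst_def Iff_def)
  qed (use assms in simp)
  with assms show ?thesis
    by (simp add: holds_def set_ext)
qed

lemma holds_mem_Compr:
  assumes "ctx w \<turnstile> x : A" "A # ctx w \<turnstile> \<phi> : Omega"
  shows "w \<Vdash> x \<^bold>\<in> Compr A \<phi> \<longleftrightarrow> w \<Vdash> inst \<phi> x"
proof -
  have "w \<Vdash> x \<^bold>\<in> Compr A \<phi> \<^bold>\<longleftrightarrow> inst \<phi> x"
    using assms by (simp add: holds_def comprehension)
  then show ?thesis
    unfolding Iff_def holds_conj by (metis holds_impE)
qed

text \<open>The truth of a membership only shows that some element type fits;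
  \<open>type_unique\<close> identifies it with the one given by the set. This spares many later
  rules a typing premise on elements.\<close>

lemma mem_typed: "w \<Vdash> x \<^bold>\<in> X \<Longrightarrow> ctx w \<turnstile> X : Power \<beta> \<Longrightarrow> ctx w \<turnstile> x : \<beta>"
  by (auto dest!: holds_typed dest: type_unique)

section \<open>Internal set theory\<close>

lemma sub_Neg [simp]: "sub \<sigma> (\<^bold>\<not> \<phi>) = (\<^bold>\<not> sub \<sigma> \<phi>)"
  by (simp add: Neg_def)

lemma sub_set_tms [simp]:
  "sub \<sigma> (empty_tm \<beta>) = empty_tm \<beta>"
  "sub \<sigma> (singleton_tm \<beta> a) = singleton_tm \<beta> (sub \<sigma> a)"
  "sub \<sigma> (union_tm \<beta> X Y) = union_tm \<beta> (sub \<sigma> X) (sub \<sigma> Y)"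
  "sub \<sigma> (diff_tm \<beta> X Y) = diff_tm \<beta> (sub \<sigma> X) (sub \<sigma> Y)"
  by (simp_all add: empty_tm_def singleton_tm_def union_tm_def diff_tm_def)

lemma sub_set_fms [simp]:
  "sub \<sigma> (subset_fm \<beta> X Y) = subset_fm \<beta> (sub \<sigma> X) (sub \<sigma> Y)"
  "sub \<sigma> (inhabited_fm \<beta> X) = inhabited_fm \<beta> (sub \<sigma> X)"
  "sub \<sigma> (proper_subset_fm \<beta> X Y) = proper_subset_fm \<beta> (sub \<sigma> X) (sub \<sigma> Y)"
  "sub \<sigma> (complemented_fm \<beta> X Y) = complemented_fm \<beta> (sub \<sigma> X) (sub \<sigma> Y)"
  by (simp_all add: subset_fm_def inhabited_fm_def proper_subset_fm_def complemented_fm_def)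

lemma set_tms_typed [simp]:
  "\<Gamma> \<turnstile> empty_tm \<beta> : C \<longleftrightarrow> C = Power \<beta>"
  "\<Gamma> \<turnstile> singleton_tm \<beta> a : C \<longleftrightarrow> C = Power \<beta> \<and> \<Gamma> \<turnstile> a : \<beta>"
  "\<Gamma> \<turnstile> union_tm \<beta> X Y : C \<longleftrightarrow> C = Power \<beta> \<and> \<Gamma> \<turnstile> X : Power \<beta> \<and> \<Gamma> \<turnstile> Y : Power \<beta>"
  "\<Gamma> \<turnstile> diff_tm \<beta> X Y : C \<longleftrightarrow> C = Power \<beta> \<and> \<Gamma> \<turnstile> X : Power \<beta> \<and> \<Gamma> \<turnstile> Y : Power \<beta>"
  by (auto simp: empty_tm_def singleton_tm_def union_tm_def diff_tm_def)

lemma set_fms_typed [simp]: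
  "\<Gamma> \<turnstile> subset_fm \<beta> X Y : C \<longleftrightarrow> C = Omega \<and> \<Gamma> \<turnstile> X : Power \<beta> \<and> \<Gamma> \<turnstile> Y : Power \<beta>"
  "\<Gamma> \<turnstile> inhabited_fm \<beta> X : C \<longleftrightarrow> C = Omega \<and> \<Gamma> \<turnstile> X : Power \<beta>"
  "\<Gamma> \<turnstile> proper_subset_fm \<beta> X Y : C \<longleftrightarrow> C = Omega \<and> \<Gamma> \<turnstile> X : Power \<beta> \<and> \<Gamma> \<turnstile> Y : Power \<beta>"
  "\<Gamma> \<turnstile> complemented_fm \<beta> X Y : C \<longleftrightarrow> C = Omega \<and> \<Gamma> \<turnstile> X : Power \<beta> \<and> \<Gamma> \<turnstile> Y : Power \<beta>"
  by (auto simp: subset_fm_def inhabited_fm_def proper_subset_fm_def complemented_fm_def)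

lemma holds_mem_empty: "w \<Vdash> x \<^bold>\<in> empty_tm \<beta> \<Longrightarrow> w \<Vdash> \<^bold>\<bottom>"
  using mem_typed[of w x "empty_tm \<beta>" \<beta>]
  by (simp add: empty_tm_def holds_mem_Compr inst_def)

lemma holds_mem_singleton:
  "ctx w \<turnstile> x : \<beta> \<Longrightarrow> ctx w \<turnstile> a : \<beta> \<Longrightarrow> w \<Vdash> x \<^bold>\<in> singleton_tm \<beta> a \<longleftrightarrow> w \<Vdash> x \<^bold>= a"
  by (simp add: singleton_tm_def holds_mem_Compr inst_def)

lemma holds_mem_union:
  "ctx w \<turnstile> x : \<beta> \<Longrightarrow> ctx w \<turnstile> X : Power \<beta> \<Longrightarrow> ctx w \<turnstile> Y : Power \<beta> \<Longrightarrow>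
    w \<Vdash> x \<^bold>\<in> union_tm \<beta> X Y \<longleftrightarrow> w \<Vdash> x \<^bold>\<in> X \<^bold>\<or> x \<^bold>\<in> Y"
  by (simp add: union_tm_def holds_mem_Compr inst_def)

lemma holds_mem_diff:
  "ctx w \<turnstile> x : \<beta> \<Longrightarrow> ctx w \<turnstile> X : Power \<beta> \<Longrightarrow> ctx w \<turnstile> Y : Power \<beta> \<Longrightarrow>
    w \<Vdash> x \<^bold>\<in> diff_tm \<beta> X Y \<longleftrightarrow> w \<Vdash> x \<^bold>\<in> X \<and> w \<Vdash> \<^bold>\<not> x \<^bold>\<in> Y"
  by (simp add: diff_tm_def holds_mem_Compr inst_def)

section \<open>Inclusion, inhabitedness and complementation\<close>

lemma holds_subsetI:
  assumes X: "ctx w \<turnstile> X : Power \<beta>" and Y: "ctx w \<turnstile> Y : Power \<beta>"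
    and XY: "\<And>v x. w \<preceq> v \<Longrightarrow> ctx v \<turnstile> x : \<beta> \<Longrightarrow> v \<Vdash> x \<^bold>\<in> X \<Longrightarrow> v \<Vdash> x \<^bold>\<in> Y"
  shows "w \<Vdash> subset_fm \<beta> X Y"
  unfolding subset_fm_def
proof (rule holds_forallI)
  fix v x
  assume v: "w \<preceq> v" and x: "ctx v \<turnstile> x : \<beta>"
  have "v \<Vdash> x \<^bold>\<in> X \<^bold>\<longrightarrow> x \<^bold>\<in> Y"
  proof (rule holds_impI)
    show "ctx v \<turnstile> x \<^bold>\<in> X : Omega"
      using x X[THEN typed_mono, OF v] by auto
  next
    fix u
    assume "v \<preceq> u" "u \<Vdash> x \<^bold>\<in> X"
    then show "u \<Vdash> x \<^bold>\<in> Y"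
      using XY[OF extends_trans[OF v] typed_mono[OF x]] by blast
  qed
  then show "v \<Vdash> inst (Var 0 \<^bold>\<in> lift X \<^bold>\<longrightarrow> Var 0 \<^bold>\<in> lift Y) x"
    by (simp add: inst_def)
qed (use X Y in simp)

lemma holds_subsetD:
  assumes "w \<Vdash> subset_fm \<beta> X Y" "w \<Vdash> x \<^bold>\<in> X"
  shows "w \<Vdash> x \<^bold>\<in> Y"
proof -
  have "ctx w \<turnstile> x : \<beta>"
    using holds_typed[OF assms(1)] mem_typed[OF assms(2)] by simp
  then show ?thesis
    using holds_forallE[OF assms(1)[unfolded subset_fm_def], of x] assms(2)
    by (simp add: inst_def holds_impE)
qed

lemma holds_subset_trans:
  assumes "w \<Vdash> subset_fm \<beta> X Y" "w \<Vdash> subset_fm \<beta> Y Z"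
  shows "w \<Vdash> subset_fm \<beta> X Z"
proof (rule holds_subsetI)
  fix v x
  assume v: "w \<preceq> v" "v \<Vdash> x \<^bold>\<in> X"
  then show "v \<Vdash> x \<^bold>\<in> Z"
    using assms[THEN holds_mono, OF v(1)] by (blast intro: holds_subsetD)
qed (use assms[THEN holds_typed] in auto)

lemma holds_inhabitedI:
  "w \<Vdash> x \<^bold>\<in> X \<Longrightarrow> ctx w \<turnstile> X : Power \<beta> \<Longrightarrow> w \<Vdash> inhabited_fm \<beta> X"
  unfolding inhabited_fm_def
  by (rule holds_existsI[of _ _ x]) (auto simp: inst_def mem_typed)

lemma holds_inhabitedE:
  assumes "w \<Vdash> inhabited_fm \<beta> X" "ctx w \<turnstile> \<psi> : Omega"
    and "\<And>v x. w \<preceq> v \<Longrightarrow> ctx v \<turnstile> x : \<beta> \<Longrightarrow> v \<Vdash> x \<^bold>\<in> X \<Longrightarrow> v \<Vdash> \<psi>"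
  shows "w \<Vdash> \<psi>"
  using assms(1,2) unfolding inhabited_fm_def
  by (rule holds_existsE) (simp add: inst_def assms(3))

text \<open>Complementation is encoded as an equation between \<open>Y\<close> and a union, so
  decidability of membership has to be turned into an extensional equality. The inclusion of the
  union in \<open>Y\<close> rests on \<open>sub\<close> for its first part.\<close>

lemma holds_complementedI:
  assumes sub: "w \<Vdash> subset_fm \<beta> X Y"
    and dec: "\<And>v x. w \<preceq> v \<Longrightarrow> ctx v \<turnstile> x : \<beta> \<Longrightarrow> v \<Vdash> x \<^bold>\<in> Y \<Longrightarrow> v \<Vdash> x \<^bold>\<in> X \<^bold>\<or> \<^bold>\<not> x \<^bold>\<in> X"
  shows "w \<Vdash> complemented_fm \<beta> X Y"
proof -
  have XY: "ctx w \<turnstile> X : Power \<beta>" "ctx w \<turnstile> Y : Power \<beta>"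
    using holds_typed[OF sub] by simp_all
  have "w \<Vdash> Y \<^bold>= union_tm \<beta> X (diff_tm \<beta> Y X)"
  proof (rule holds_set_eqI)
    fix v x
    assume v: "w \<preceq> v" and x: "ctx v \<turnstile> x : \<beta>" and xY: "v \<Vdash> x \<^bold>\<in> Y"
    note t = XY[THEN typed_mono, OF v]
    have "v \<Vdash> x \<^bold>\<in> X \<^bold>\<or> x \<^bold>\<in> diff_tm \<beta> Y X"
    proof (rule holds_disjE[OF dec[OF v x xY]])
      fix u
      assume u: "v \<preceq> u" "u \<Vdash> x \<^bold>\<in> X"
      then show "u \<Vdash> x \<^bold>\<in> X \<^bold>\<or> x \<^bold>\<in> diff_tm \<beta> Y X"
        using t[THEN typed_mono, OF u(1)] x[THEN typed_mono, OF u(1)]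
        by (auto intro: holds_disjI1)
    next
      fix u
      assume u: "v \<preceq> u" "u \<Vdash> \<^bold>\<not> x \<^bold>\<in> X"
      note t' = t[THEN typed_mono, OF u(1)] x[THEN typed_mono, OF u(1)]
      have "u \<Vdash> x \<^bold>\<in> diff_tm \<beta> Y X"
        using u t' holds_mono[OF xY] by (simp add: holds_mem_diff)
      then show "u \<Vdash> x \<^bold>\<in> X \<^bold>\<or> x \<^bold>\<in> diff_tm \<beta> Y X"
        by (rule holds_disjI2) (use t' in auto)
    qed
    then show "v \<Vdash> x \<^bold>\<in> union_tm \<beta> X (diff_tm \<beta> Y X)"
      using t x by (simp add: holds_mem_union)
  next
    fix v x
    assume v: "w \<preceq> v" and x: "ctx v \<turnstile> x : \<beta>" and "v \<Vdash> x \<^bold>\<in> union_tm \<beta> X (diff_tm \<beta> Y X)"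
    note t = XY[THEN typed_mono, OF v]
    have "v \<Vdash> x \<^bold>\<in> X \<^bold>\<or> x \<^bold>\<in> diff_tm \<beta> Y X"
      using \<open>v \<Vdash> x \<^bold>\<in> union_tm \<beta> X (diff_tm \<beta> Y X)\<close> t x by (simp add: holds_mem_union)
    then show "v \<Vdash> x \<^bold>\<in> Y"
    proof (rule holds_disjE)
      fix u
      assume u: "v \<preceq> u" "u \<Vdash> x \<^bold>\<in> X"
      show "u \<Vdash> x \<^bold>\<in> Y"
        using holds_mono[OF sub extends_trans[OF v u(1)]] u(2) by (rule holds_subsetD)
    next
      fix u
      assume u: "v \<preceq> u" "u \<Vdash> x \<^bold>\<in> diff_tm \<beta> Y X"
      then show "u \<Vdash> x \<^bold>\<in> Y"
        using t[THEN typed_mono, OF u(1)] x[THEN typed_mono, OF u(1)] by (simp add: holds_mem_diff)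
    qed
  qed (use XY in simp_all)
  with sub show ?thesis
    by (simp add: complemented_fm_def)
qed

text \<open>Rewriting along the encoded equation puts \<open>x\<close> into the union; membership in
  the difference then supplies the negation.\<close>

lemma holds_complementedD:
  assumes c: "w \<Vdash> complemented_fm \<beta> X Y" and xY: "w \<Vdash> x \<^bold>\<in> Y"
  shows "w \<Vdash> x \<^bold>\<in> X \<^bold>\<or> \<^bold>\<not> x \<^bold>\<in> X"
proof -
  have t: "ctx w \<turnstile> X : Power \<beta>" "ctx w \<turnstile> Y : Power \<beta>"
    using holds_typed[OF c] by simp_all
  have x: "ctx w \<turnstile> x : \<beta>"
    using xY t by (blast intro: mem_typed)
  have "w \<Vdash> x \<^bold>\<in> union_tm \<beta> X (diff_tm \<beta> Y X)"
    using c xY by (auto simp: complemented_fm_def intro: holds_mem_eq)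
  then have "w \<Vdash> x \<^bold>\<in> X \<^bold>\<or> x \<^bold>\<in> diff_tm \<beta> Y X"
    using t x by (simp add: holds_mem_union)
  then show ?thesis
  proof (rule holds_disjE)
    fix v
    assume v: "w \<preceq> v" "v \<Vdash> x \<^bold>\<in> X"
    show "v \<Vdash> x \<^bold>\<in> X \<^bold>\<or> \<^bold>\<not> x \<^bold>\<in> X"
      using v(2) by (rule holds_disjI1) (use holds_typed[OF v(2)] in simp)
  next
    fix v
    assume v: "w \<preceq> v" "v \<Vdash> x \<^bold>\<in> diff_tm \<beta> Y X"
    then have "v \<Vdash> \<^bold>\<not> x \<^bold>\<in> X"
      using t[THEN typed_mono, OF v(1)] x[THEN typed_mono, OF v(1)] by (simp add: holds_mem_diff)
    then show "v \<Vdash> x \<^bold>\<in> X \<^bold>\<or> \<^bold>\<not> x \<^bold>\<in> X"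
      by (rule holds_disjI2) (use holds_typed[OF \<open>v \<Vdash> \<^bold>\<not> x \<^bold>\<in> X\<close>] in simp)
  qed
qed

lemma holds_complemented_subset: "w \<Vdash> complemented_fm \<beta> X Y \<Longrightarrow> w \<Vdash> subset_fm \<beta> X Y"
  by (simp add: complemented_fm_def)

text \<open>Finiteness quantifies over internal families of sets. The induction predicate is
  therefore a formula \<open>Q\<close> with a free set variable at index 0, and its comprehension is
  the family to which finiteness is applied.\<close>

lemma holds_finite_induct:
  assumes fin: "w \<Vdash> finite_fm \<beta> A" and A: "ctx w \<turnstile> A : Power \<beta>"
    and Q: "Power \<beta> # ctx w \<turnstile> Q : Omega"
    and empty: "w \<Vdash> inst Q (empty_tm \<beta>)"
    and insert: "\<And>v Z a. w \<preceq> v \<Longrightarrow> ctx v \<turnstile> Z : Power \<beta> \<Longrightarrow> ctx v \<turnstile> a : \<beta> \<Longrightarrow>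
      v \<Vdash> inst Q Z \<Longrightarrow> v \<Vdash> a \<^bold>\<in> A \<Longrightarrow> v \<Vdash> inst Q (union_tm \<beta> Z (singleton_tm \<beta> a))"
  shows "w \<Vdash> inst Q A"
proof -
  let ?Y = "Compr (Power \<beta>) Q"
  have Y: "ctx w \<turnstile> ?Y : Power (Power \<beta>)"
    using Q by simp
  \<comment> \<open>Stated for all later worlds, because the closure condition is verified
    there.\<close>
  have Y_iff: "v \<Vdash> Z \<^bold>\<in> ?Y \<longleftrightarrow> v \<Vdash> inst Q Z" if "w \<preceq> v" "ctx v \<turnstile> Z : Power \<beta>" for v Z
  proof (rule holds_mem_Compr)
    show "Power \<beta> # ctx v \<turnstile> Q : Omega"
      using typed_mono[OF Y that(1)] by simp
  qed (fact that)
  let ?\<psi> = "\<lambda>Y. Var 1 \<^bold>\<in> lift (lift Y) \<^bold>\<and> Var 0 \<^bold>\<in> lift (lift A)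
    \<^bold>\<longrightarrow> union_tm \<beta> (Var 1) (singleton_tm \<beta> (Var 0)) \<^bold>\<in> lift (lift Y)"
  have "w \<Vdash> Forall (Power \<beta>) (Forall \<beta> (?\<psi> ?Y))"
  proof (rule holds_forallI)
    fix v Z
    assume v: "w \<preceq> v" and Z: "ctx v \<turnstile> Z : Power \<beta>"
    note AY = A[THEN typed_mono, OF v] Y[THEN typed_mono, OF v]
    have "v \<Vdash> Forall \<beta> (lift Z \<^bold>\<in> lift ?Y \<^bold>\<and> Var 0 \<^bold>\<in> lift A
      \<^bold>\<longrightarrow> union_tm \<beta> (lift Z) (singleton_tm \<beta> (Var 0)) \<^bold>\<in> lift ?Y)"
    proof (rule holds_forallI)
      fix u a
      assume u: "v \<preceq> u" and a: "ctx u \<turnstile> a : \<beta>"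
      have "u \<Vdash> Z \<^bold>\<in> ?Y \<^bold>\<and> a \<^bold>\<in> A \<^bold>\<longrightarrow> union_tm \<beta> Z (singleton_tm \<beta> a) \<^bold>\<in> ?Y"
      proof (rule holds_impI)
        show "ctx u \<turnstile> Z \<^bold>\<in> ?Y \<^bold>\<and> a \<^bold>\<in> A : Omega"
          using AY[THEN typed_mono, OF u] Z[THEN typed_mono, OF u] a by auto
      next
        fix u'
        assume u': "u \<preceq> u'" and h: "u' \<Vdash> Z \<^bold>\<in> ?Y \<^bold>\<and> a \<^bold>\<in> A"
        note w' = extends_trans[OF v extends_trans[OF u u']]
        have t: "ctx u' \<turnstile> Z : Power \<beta>" "ctx u' \<turnstile> a : \<beta>"
          using typed_mono[OF Z extends_trans[OF u u']] typed_mono[OF a u'] .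
        show "u' \<Vdash> union_tm \<beta> Z (singleton_tm \<beta> a) \<^bold>\<in> ?Y"
          using insert[OF w' t] h Y_iff[OF w'] t by simp
      qed
      then show "u \<Vdash> inst (lift Z \<^bold>\<in> lift ?Y \<^bold>\<and> Var 0 \<^bold>\<in> lift A
          \<^bold>\<longrightarrow> union_tm \<beta> (lift Z) (singleton_tm \<beta> (Var 0)) \<^bold>\<in> lift ?Y) a"
        \<comment> \<open>Unfolding the renaming would push the lift inside the comprehension
          \<open>?Y\<close>; keeping \<open>lift ?Y\<close> intact lets the instantiation cancel
          it.\<close>
        by (simp add: inst_def del: ren.simps)
    qed (use AY Z in \<open>auto simp del: ren.simps(4)\<close>)
    then show "v \<Vdash> inst (Forall \<beta> (?\<psi> ?Y)) Z"
      by (simp add: inst_def del: ren.simps)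
  qed (use A Y in \<open>auto simp del: ren.simps(4)\<close>)
  moreover have "w \<Vdash> empty_tm \<beta> \<^bold>\<in> ?Y"
    using empty by (simp add: Y_iff)
  moreover have "w \<Vdash> (empty_tm \<beta> \<^bold>\<in> ?Y \<^bold>\<and> Forall (Power \<beta>) (Forall \<beta> (?\<psi> ?Y))) \<^bold>\<longrightarrow> A \<^bold>\<in> ?Y"
    using holds_forallE[OF fin[unfolded finite_fm_def] Y]
    \<comment> \<open>Writing the index 2 of the family as a successor lets the substitution under
      the two inner binders compute.\<close>
    by (simp add: inst_def numeral_2_eq_2)
  ultimately have "w \<Vdash> A \<^bold>\<in> ?Y"
    by (metis holds_conj holds_impE)
  then show ?thesis
    by (simp add: Y_iff A)
qed

section \<open>Preimages under a partial map\<close>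

definition preimage_tm :: "'g ty \<Rightarrow> 'g tm \<Rightarrow> 'g tm \<Rightarrow> 'g tm" where
  "preimage_tm \<beta> f T =
    Compr \<beta> (Exists \<beta> (Tuple (Var 1) (Var 0) \<^bold>\<in> lift (lift f) \<^bold>\<and> Var 0 \<^bold>\<in> lift (lift T)))"

lemma sub_preimage_tm [simp]:
  "sub \<sigma> (preimage_tm \<beta> f T) = preimage_tm \<beta> (sub \<sigma> f) (sub \<sigma> T)"
  by (simp add: preimage_tm_def)

lemma preimage_tm_typed:
  "\<Gamma> \<turnstile> f : Power (Times \<beta> \<beta>) \<Longrightarrow> \<Gamma> \<turnstile> preimage_tm \<beta> f T : C \<longleftrightarrow> C = Power \<beta> \<and> \<Gamma> \<turnstile> T : Power \<beta>"
  by (auto simp: preimage_tm_def)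

text \<open>All assumptions persist to later worlds, so proofs interpret the locale again at each
  world they pass to. The map is partial when seen on \<open>B\<close>, its domain being
  \<open>A\<close>.\<close>

locale partial_map =
  fixes w :: "'g world" and \<beta> :: "'g ty" and A B f :: "'g tm"
  assumes f_typed [simp]: "ctx w \<turnstile> f : Power (Times \<beta> \<beta>)"
    and f: "w \<Vdash> function_fm \<beta> f A B"
    and A_complemented: "w \<Vdash> complemented_fm \<beta> A B"
begin

lemma mono: "w \<preceq> v \<Longrightarrow> partial_map v \<beta> A B f"
  unfolding partial_map_def using f_typed f A_complemented by (blast intro: typed_mono holds_mono)

lemma AB_typed [simp]: "ctx w \<turnstile> A : Power \<beta>" "ctx w \<turnstile> B : Power \<beta>"
  using holds_typed[OF A_complemented] by simp_all

lemmas preimage_typed [simp] = preimage_tm_typed[OF f_typed]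

section \<open>Values of the map\<close>

lemma pair_typed: "w \<Vdash> Tuple x y \<^bold>\<in> f \<Longrightarrow> ctx w \<turnstile> x : \<beta> \<and> ctx w \<turnstile> y : \<beta>"
  using mem_typed[OF _ f_typed, of "Tuple x y"] by simp

lemma graph_subset:
  assumes "w \<Vdash> Tuple x y \<^bold>\<in> f"
  shows "w \<Vdash> x \<^bold>\<in> A" "w \<Vdash> y \<^bold>\<in> B"
proof -
  have "w \<Vdash> Forall \<beta> (Forall \<beta> (Tuple (Var 1) (Var 0) \<^bold>\<in> lift (lift f) \<^bold>\<longrightarrow>
      Var 1 \<^bold>\<in> lift (lift A) \<^bold>\<and> Var 0 \<^bold>\<in> lift (lift B)))"
    using f by (simp add: function_fm_def)
  from holds_forallE[OF this] pair_typed[OF assms]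
  have "w \<Vdash> Forall \<beta> (Tuple (lift x) (Var 0) \<^bold>\<in> lift f \<^bold>\<longrightarrow> lift x \<^bold>\<in> lift A \<^bold>\<and> Var 0 \<^bold>\<in> lift B)"
    by (force simp: inst_def)
  from holds_forallE[OF this] pair_typed[OF assms]
  have "w \<Vdash> Tuple x y \<^bold>\<in> f \<^bold>\<longrightarrow> x \<^bold>\<in> A \<^bold>\<and> y \<^bold>\<in> B"
    by (force simp: inst_def)
  from holds_impE[OF this assms] show "w \<Vdash> x \<^bold>\<in> A" "w \<Vdash> y \<^bold>\<in> B"
    by simp_all
qed

text \<open>The language has no application term. A value of \<open>x\<close> is available only at a
  later world, inside a continuation that proves \<psi>.\<close>

lemma totalE:
  assumes "w \<Vdash> x \<^bold>\<in> A" "ctx w \<turnstile> \<psi> : Omega"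
    and "\<And>v y. w \<preceq> v \<Longrightarrow> v \<Vdash> Tuple x y \<^bold>\<in> f \<Longrightarrow> v \<Vdash> \<psi>"
  shows "w \<Vdash> \<psi>"
proof -
  have x: "ctx w \<turnstile> x : \<beta>"
    using assms(1) by (rule mem_typed) simp
  have "w \<Vdash> Forall \<beta> (Var 0 \<^bold>\<in> lift A \<^bold>\<longrightarrow> Exists \<beta> (Tuple (Var 1) (Var 0) \<^bold>\<in> lift (lift f)))"
    using f by (simp add: function_fm_def)
  from holds_forallE[OF this x] have "w \<Vdash> Exists \<beta> (Tuple (lift x) (Var 0) \<^bold>\<in> lift f)"
    using assms(1) by (simp add: inst_def holds_impE)
  then show ?thesis
    using assms(2) by (rule holds_existsE) (simp add: inst_def assms(3))
qed

lemma single_valued: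
  assumes "w \<Vdash> Tuple x y \<^bold>\<in> f" "w \<Vdash> Tuple x z \<^bold>\<in> f"
  shows "w \<Vdash> y \<^bold>= z"
proof -
  note t = pair_typed[OF assms(1)] pair_typed[OF assms(2)]
  have "w \<Vdash> Forall \<beta> (Forall \<beta> (Forall \<beta>
       (Tuple (Var 2) (Var 1) \<^bold>\<in> lift (lift (lift f)) \<^bold>\<and>
        Tuple (Var 2) (Var 0) \<^bold>\<in> lift (lift (lift f)) \<^bold>\<longrightarrow> Var 1 \<^bold>= Var 0)))"
    using f by (simp add: function_fm_def)
  from holds_forallE[OF this, of x] t
  have "w \<Vdash> Forall \<beta> (Forall \<beta>
       (Tuple (lift (lift x)) (Var 1) \<^bold>\<in> lift (lift f) \<^bold>\<and>
        Tuple (lift (lift x)) (Var 0) \<^bold>\<in> lift (lift f) \<^bold>\<longrightarrow> Var 1 \<^bold>= Var 0))"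
    by (simp add: inst_def numeral_2_eq_2)
  from holds_forallE[OF this, of y] t
  have "w \<Vdash> Forall \<beta>
       (Tuple (lift x) (lift y) \<^bold>\<in> lift f \<^bold>\<and> Tuple (lift x) (Var 0) \<^bold>\<in> lift f \<^bold>\<longrightarrow> lift y \<^bold>= Var 0)"
    by (simp add: inst_def)
  from holds_forallE[OF this, of z] t
  have "w \<Vdash> Tuple x y \<^bold>\<in> f \<^bold>\<and> Tuple x z \<^bold>\<in> f \<^bold>\<longrightarrow> y \<^bold>= z"
    by (simp add: inst_def)
  with assms show ?thesis
    by (metis holds_conj holds_impE)
qed

section \<open>Membership in preimages and its decidability\<close>

lemma holds_mem_preimage:
  assumes "ctx w \<turnstile> x : \<beta>" "ctx w \<turnstile> T : Power \<beta>"
  shows "w \<Vdash> x \<^bold>\<in> preimage_tm \<beta> f T \<longleftrightarrow>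
    w \<Vdash> Exists \<beta> (Tuple (lift x) (Var 0) \<^bold>\<in> lift f \<^bold>\<and> Var 0 \<^bold>\<in> lift T)"
  using assms by (simp add: preimage_tm_def holds_mem_Compr inst_def)

lemma preimageI:
  assumes "w \<Vdash> Tuple x y \<^bold>\<in> f" "w \<Vdash> y \<^bold>\<in> T"
  shows "w \<Vdash> x \<^bold>\<in> preimage_tm \<beta> f T"
proof -
  note t = pair_typed[OF assms(1)]
  have T: "ctx w \<turnstile> T : Power \<beta>"
    using holds_typed[OF assms(2)] t by (auto dest: type_unique)
  have "w \<Vdash> Exists \<beta> (Tuple (lift x) (Var 0) \<^bold>\<in> lift f \<^bold>\<and> Var 0 \<^bold>\<in> lift T)"
  proof (rule holds_existsI)
    show "w \<Vdash> inst (Tuple (lift x) (Var 0) \<^bold>\<in> lift f \<^bold>\<and> Var 0 \<^bold>\<in> lift T) y"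
      using assms by (simp add: inst_def)
    show "\<beta> # ctx w \<turnstile> Tuple (lift x) (Var 0) \<^bold>\<in> lift f \<^bold>\<and> Var 0 \<^bold>\<in> lift T : Omega"
      using t T by force
  qed (use t in blast)
  then show ?thesis
    using t T by (simp add: holds_mem_preimage)
qed

lemma preimageE:
  assumes "w \<Vdash> x \<^bold>\<in> preimage_tm \<beta> f T" "ctx w \<turnstile> T : Power \<beta>" "ctx w \<turnstile> \<psi> : Omega"
    and "\<And>v y. w \<preceq> v \<Longrightarrow> v \<Vdash> Tuple x y \<^bold>\<in> f \<Longrightarrow> v \<Vdash> y \<^bold>\<in> T \<Longrightarrow> v \<Vdash> \<psi>"
  shows "w \<Vdash> \<psi>"
proof -
  have "ctx w \<turnstile> x : \<beta>"
    using assms(1) by (rule mem_typed) (simp add: assms(2))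
  then have "w \<Vdash> Exists \<beta> (Tuple (lift x) (Var 0) \<^bold>\<in> lift f \<^bold>\<and> Var 0 \<^bold>\<in> lift T)"
    using assms(1,2) by (simp add: holds_mem_preimage)
  then show ?thesis
    using assms(3) by (rule holds_existsE) (auto simp: inst_def intro: assms(4))
qed

text \<open>Membership in the preimage provides some value in \<open>T\<close>; single-valuedness
  identifies it with the given \<open>y\<close>.\<close>

lemma preimage_value:
  assumes "w \<Vdash> x \<^bold>\<in> preimage_tm \<beta> f T" "w \<Vdash> Tuple x y \<^bold>\<in> f" "ctx w \<turnstile> T : Power \<beta>"
  shows "w \<Vdash> y \<^bold>\<in> T"
  using assms(1,3)
proof (rule preimageE)
  show "ctx w \<turnstile> y \<^bold>\<in> T : Omega"
    using pair_typed[OF assms(2)] assms(3) by auto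
next
  fix v z
  assume v: "w \<preceq> v" "v \<Vdash> Tuple x z \<^bold>\<in> f" "v \<Vdash> z \<^bold>\<in> T"
  interpret V: partial_map v \<beta> A B f
    using v(1) by (rule mono)
  have "v \<Vdash> z \<^bold>= y"
    using v(2) holds_mono[OF assms(2) v(1)] by (rule V.single_valued)
  then show "v \<Vdash> y \<^bold>\<in> T"
    using v(3) by (rule holds_eq_mem)
qed

lemma preimage_mono:
  assumes "w \<Vdash> subset_fm \<beta> T U"
  shows "w \<Vdash> subset_fm \<beta> (preimage_tm \<beta> f T) (preimage_tm \<beta> f U)"
proof (rule holds_subsetI)
  have TU: "ctx w \<turnstile> T : Power \<beta>" "ctx w \<turnstile> U : Power \<beta>"
    using holds_typed[OF assms] by simp_all
  show "ctx w \<turnstile> preimage_tm \<beta> f T : Power \<beta>" "ctx w \<turnstile> preimage_tm \<beta> f U : Power \<beta>"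
    using TU by simp_all
  fix v x
  assume v: "w \<preceq> v" and x: "ctx v \<turnstile> x : \<beta>" and xT: "v \<Vdash> x \<^bold>\<in> preimage_tm \<beta> f T"
  interpret V: partial_map v \<beta> A B f
    using v by (rule mono)
  note TU' = TU[THEN typed_mono, OF v]
  show "v \<Vdash> x \<^bold>\<in> preimage_tm \<beta> f U"
    using xT TU'(1)
  proof (rule V.preimageE)
    show "ctx v \<turnstile> x \<^bold>\<in> preimage_tm \<beta> f U : Omega"
      using x TU' by auto
  next
    fix u y
    assume u: "v \<preceq> u" "u \<Vdash> Tuple x y \<^bold>\<in> f" "u \<Vdash> y \<^bold>\<in> T"
    interpret U: partial_map u \<beta> A B f
      using u(1) by (rule V.mono)
    have "u \<Vdash> y \<^bold>\<in> U"
      using holds_mono[OF assms extends_trans[OF v u(1)]] u(3) by (rule holds_subsetD)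
    with u(2) show "u \<Vdash> x \<^bold>\<in> preimage_tm \<beta> f U"
      by (rule U.preimageI)
  qed
qed

lemma preimage_subset_domain:
  assumes T: "ctx w \<turnstile> T : Power \<beta>"
  shows "w \<Vdash> subset_fm \<beta> (preimage_tm \<beta> f T) A"
proof (rule holds_subsetI)
  fix v x
  assume v: "w \<preceq> v" and x: "ctx v \<turnstile> x : \<beta>" and xT: "v \<Vdash> x \<^bold>\<in> preimage_tm \<beta> f T"
  interpret V: partial_map v \<beta> A B f
    using v by (rule mono)
  show "v \<Vdash> x \<^bold>\<in> A"
    using xT typed_mono[OF T v]
  proof (rule V.preimageE)
    show "ctx v \<turnstile> x \<^bold>\<in> A : Omega"
      using x V.AB_typed by auto
  next
    fix u y
    assume u: "v \<preceq> u" "u \<Vdash> Tuple x y \<^bold>\<in> f"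
    interpret U: partial_map u \<beta> A B f
      using u(1) by (rule V.mono)
    show "u \<Vdash> x \<^bold>\<in> A"
      using u(2) by (rule U.graph_subset)
  qed
qed (use T in simp_all)

text \<open>Two decisions suffice: whether \<open>x\<close> is in the domain \<open>A\<close>, and
  if so, whether its value is in \<open>T\<close>. This keeps every set of the descent decidable
  without excluded middle.\<close>

lemma preimage_complemented:
  assumes T: "w \<Vdash> complemented_fm \<beta> T B"
  shows "w \<Vdash> complemented_fm \<beta> (preimage_tm \<beta> f T) B"
proof (rule holds_complementedI)
  have Tt: "ctx w \<turnstile> T : Power \<beta>"
    using holds_typed[OF T] by simp
  note pre_A = preimage_subset_domain[OF Tt]
  show "w \<Vdash> subset_fm \<beta> (preimage_tm \<beta> f T) B"
    using pre_A holds_complemented_subset[OF A_complemented] by (rule holds_subset_trans)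
  let ?P = "\<lambda>x. x \<^bold>\<in> preimage_tm \<beta> f T"
  fix v x
  assume v: "w \<preceq> v" and x: "ctx v \<turnstile> x : \<beta>" and xB: "v \<Vdash> x \<^bold>\<in> B"
  interpret V: partial_map v \<beta> A B f
    using v by (rule mono)
  note Tt' = typed_mono[OF Tt v]
  have Pt: "ctx v \<turnstile> ?P x : Omega"
    using x Tt' by auto
  from V.A_complemented xB have "v \<Vdash> x \<^bold>\<in> A \<^bold>\<or> \<^bold>\<not> x \<^bold>\<in> A"
    by (rule holds_complementedD)
  then show "v \<Vdash> ?P x \<^bold>\<or> \<^bold>\<not> ?P x"
  proof (rule holds_disjE)
    fix u
    assume u: "v \<preceq> u" "u \<Vdash> x \<^bold>\<in> A"
    interpret U: partial_map u \<beta> A B f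
      using u(1) by (rule V.mono)
    note Pt_u = typed_mono[OF Pt u(1)]
    from u(2) show "u \<Vdash> ?P x \<^bold>\<or> \<^bold>\<not> ?P x"
    proof (rule U.totalE)
      show "ctx u \<turnstile> ?P x \<^bold>\<or> \<^bold>\<not> ?P x : Omega"
        using Pt_u by simp
      fix r y
      assume r: "u \<preceq> r" "r \<Vdash> Tuple x y \<^bold>\<in> f"
      interpret R: partial_map r \<beta> A B f
        using r(1) by (rule U.mono)
      note wr = extends_trans[OF v extends_trans[OF u(1) r(1)]]
      note Pt_r = typed_mono[OF Pt_u r(1)]
      \<comment> \<open>The value lies in \<open>B\<close>, and there membership in \<open>T\<close>
        is decidable.\<close>
      have "r \<Vdash> y \<^bold>\<in> B"
        using r(2) by (rule R.graph_subset)
      with holds_mono[OF T wr] have "r \<Vdash> y \<^bold>\<in> T \<^bold>\<or> \<^bold>\<not> y \<^bold>\<in> T"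
        by (rule holds_complementedD)
      then show "r \<Vdash> ?P x \<^bold>\<or> \<^bold>\<not> ?P x"
      proof (rule holds_disjE)
        fix q
        assume q: "r \<preceq> q" "q \<Vdash> y \<^bold>\<in> T"
        interpret Q: partial_map q \<beta> A B f
          using q(1) by (rule R.mono)
        have "q \<Vdash> ?P x"
          using holds_mono[OF r(2) q(1)] q(2) by (rule Q.preimageI)
        then show "q \<Vdash> ?P x \<^bold>\<or> \<^bold>\<not> ?P x"
          by (rule holds_disjI1) (simp only: Neg_typed typed_mono[OF Pt_r q(1)])
      next
        fix q
        assume q: "r \<preceq> q" "q \<Vdash> \<^bold>\<not> y \<^bold>\<in> T"
        have "q \<Vdash> \<^bold>\<not> ?P x"
        proof (rule holds_negI)
          show "ctx q \<turnstile> ?P x : Omega"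
            using Pt_r q(1) by (rule typed_mono)
          fix p
          assume p: "q \<preceq> p" "p \<Vdash> ?P x"
          note rp = extends_trans[OF q(1) p(1)]
          interpret P: partial_map p \<beta> A B f
            using rp by (rule R.mono)
          have "p \<Vdash> y \<^bold>\<in> T"
            using p(2) holds_mono[OF r(2) rp] typed_mono[OF Tt extends_trans[OF wr rp]]
            by (rule P.preimage_value)
          with holds_mono[OF q(2) p(1)] show "p \<Vdash> \<^bold>\<bottom>"
            by (rule holds_negE) simp
        qed
        then show "q \<Vdash> ?P x \<^bold>\<or> \<^bold>\<not> ?P x"
          by (rule holds_disjI2) (rule typed_mono[OF Pt_r q(1)])
      qed
    qed
  next
    fix u
    assume u: "v \<preceq> u" "u \<Vdash> \<^bold>\<not> x \<^bold>\<in> A"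
    \<comment> \<open>Outside the domain there is no value, so \<open>x\<close> cannot be in the
      preimage.\<close>
    have "u \<Vdash> \<^bold>\<not> ?P x"
    proof (rule holds_negI)
      show "ctx u \<turnstile> ?P x : Omega"
        using Pt u(1) by (rule typed_mono)
      fix r
      assume r: "u \<preceq> r" "r \<Vdash> ?P x"
      have "r \<Vdash> x \<^bold>\<in> A"
        using holds_mono[OF pre_A extends_trans[OF v extends_trans[OF u(1) r(1)]]] r(2)
        by (rule holds_subsetD)
      with holds_mono[OF u(2) r(1)] show "r \<Vdash> \<^bold>\<bottom>"
        by (rule holds_negE) simp
    qed
    then show "u \<Vdash> ?P x \<^bold>\<or> \<^bold>\<not> ?P x"
      by (rule holds_disjI2) (rule typed_mono[OF Pt u(1)])
  qed
qed

end

section \<open>Stabilization\<close>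

definition good_fm :: "'g ty \<Rightarrow> 'g tm \<Rightarrow> 'g tm \<Rightarrow> 'g tm \<Rightarrow> 'g tm" where
  "good_fm \<beta> B f T = (complemented_fm \<beta> T B \<^bold>\<and> proper_subset_fm \<beta> (preimage_tm \<beta> f T) T)"

text \<open>The bound \<open>Z\<close> is what the induction enlarges. For a good \<open>T\<close>
  and \<open>Z\<close> equal to the domain, this says that the first and second preimages of
  \<open>T\<close> coincide, as preimages always lie in the domain.\<close>

definition settled_fm :: "'g ty \<Rightarrow> 'g tm \<Rightarrow> 'g tm \<Rightarrow> 'g tm \<Rightarrow> 'g tm" where
  "settled_fm \<beta> f Z T = Forall \<beta> (Var 0 \<^bold>\<in> lift Z \<^bold>\<and> Var 0 \<^bold>\<in> lift (preimage_tm \<beta> f T) \<^bold>\<longrightarrow>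
    Var 0 \<^bold>\<in> lift (preimage_tm \<beta> f (preimage_tm \<beta> f T)))"

definition settles_below_fm :: "'g ty \<Rightarrow> 'g tm \<Rightarrow> 'g tm \<Rightarrow> 'g tm \<Rightarrow> 'g tm \<Rightarrow> 'g tm" where
  "settles_below_fm \<beta> B f Z S = Exists (Power \<beta>) (good_fm \<beta> (lift B) (lift f) (Var 0) \<^bold>\<and>
    subset_fm \<beta> (Var 0) (lift S) \<^bold>\<and> settled_fm \<beta> (lift f) (lift Z) (Var 0))"

text \<open>This is the induction predicate in \<open>Z\<close>. The starting set is quantified
  inside it because the inductive step applies the hypothesis to two different good sets.\<close>

definition stabilizes_fm :: "'g ty \<Rightarrow> 'g tm \<Rightarrow> 'g tm \<Rightarrow> 'g tm \<Rightarrow> 'g tm" where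
  "stabilizes_fm \<beta> B f Z = Forall (Power \<beta>) (good_fm \<beta> (lift B) (lift f) (Var 0) \<^bold>\<longrightarrow>
    settles_below_fm \<beta> (lift B) (lift f) (lift Z) (Var 0))"

lemma sub_good_fm [simp]:
  "sub \<sigma> (good_fm \<beta> B f T) = good_fm \<beta> (sub \<sigma> B) (sub \<sigma> f) (sub \<sigma> T)"
  by (simp add: good_fm_def)

lemma sub_settled_fm [simp]:
  "sub \<sigma> (settled_fm \<beta> f Z T) = settled_fm \<beta> (sub \<sigma> f) (sub \<sigma> Z) (sub \<sigma> T)"
  by (simp add: settled_fm_def)

lemma sub_settles_below_fm [simp]:
  "sub \<sigma> (settles_below_fm \<beta> B f Z S) =
    settles_below_fm \<beta> (sub \<sigma> B) (sub \<sigma> f) (sub \<sigma> Z) (sub \<sigma> S)"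
  by (simp add: settles_below_fm_def)

lemma sub_stabilizes_fm [simp]:
  "sub \<sigma> (stabilizes_fm \<beta> B f Z) = stabilizes_fm \<beta> (sub \<sigma> B) (sub \<sigma> f) (sub \<sigma> Z)"
  by (simp add: stabilizes_fm_def)

lemma good_fm_typed:
  "\<Gamma> \<turnstile> f : Power (Times \<beta> \<beta>) \<Longrightarrow>
    \<Gamma> \<turnstile> good_fm \<beta> B f T : C \<longleftrightarrow> C = Omega \<and> \<Gamma> \<turnstile> B : Power \<beta> \<and> \<Gamma> \<turnstile> T : Power \<beta>"
  by (auto simp: good_fm_def preimage_tm_typed)

lemma settled_fm_typed:
  "\<Gamma> \<turnstile> f : Power (Times \<beta> \<beta>) \<Longrightarrow>
    \<Gamma> \<turnstile> settled_fm \<beta> f Z T : C \<longleftrightarrow> C = Omega \<and> \<Gamma> \<turnstile> Z : Power \<beta> \<and> \<Gamma> \<turnstile> T : Power \<beta>"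
  by (auto simp: settled_fm_def preimage_tm_typed)

lemma settles_below_fm_typed:
  "\<Gamma> \<turnstile> f : Power (Times \<beta> \<beta>) \<Longrightarrow> \<Gamma> \<turnstile> settles_below_fm \<beta> B f Z S : C \<longleftrightarrow>
    C = Omega \<and> \<Gamma> \<turnstile> B : Power \<beta> \<and> \<Gamma> \<turnstile> Z : Power \<beta> \<and> \<Gamma> \<turnstile> S : Power \<beta>"
  by (auto simp: settles_below_fm_def good_fm_typed settled_fm_typed)

lemma stabilizes_fm_typed:
  "\<Gamma> \<turnstile> f : Power (Times \<beta> \<beta>) \<Longrightarrow>
    \<Gamma> \<turnstile> stabilizes_fm \<beta> B f Z : C \<longleftrightarrow> C = Omega \<and> \<Gamma> \<turnstile> B : Power \<beta> \<and> \<Gamma> \<turnstile> Z : Power \<beta>"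
  by (auto simp: stabilizes_fm_def good_fm_typed settles_below_fm_typed)

context partial_map
begin

abbreviation pre :: "'g tm \<Rightarrow> 'g tm" where
  "pre \<equiv> preimage_tm \<beta> f"

lemmas stabilization_typed [simp] =
  good_fm_typed[OF f_typed] settled_fm_typed[OF f_typed]
  settles_below_fm_typed[OF f_typed] stabilizes_fm_typed[OF f_typed]

section \<open>Rules for good sets, settled elements and stabilization\<close>

lemma goodI:
  assumes "w \<Vdash> complemented_fm \<beta> T B" "w \<Vdash> subset_fm \<beta> (pre T) T"
    and "w \<Vdash> x \<^bold>\<in> T" "w \<Vdash> \<^bold>\<not> x \<^bold>\<in> pre T"
  shows "w \<Vdash> good_fm \<beta> B f T"
proof -
  have T: "ctx w \<turnstile> T : Power \<beta>"
    using holds_typed[OF assms(1)] by simp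
  have "ctx w \<turnstile> x : \<beta>"
    using assms(3) T by (rule mem_typed)
  then have "w \<Vdash> x \<^bold>\<in> diff_tm \<beta> T (pre T)"
    using assms(3,4) T by (simp add: holds_mem_diff)
  then have "w \<Vdash> inhabited_fm \<beta> (diff_tm \<beta> T (pre T))"
    by (rule holds_inhabitedI) (simp add: T)
  with assms(1,2) show ?thesis
    by (simp add: good_fm_def proper_subset_fm_def)
qed

lemma goodD:
  assumes "w \<Vdash> good_fm \<beta> B f T"
  shows "w \<Vdash> complemented_fm \<beta> T B" "w \<Vdash> subset_fm \<beta> (pre T) T"
    "w \<Vdash> inhabited_fm \<beta> (diff_tm \<beta> T (pre T))"
  using assms by (simp_all add: good_fm_def proper_subset_fm_def)

lemma settledI:
  assumes Z: "ctx w \<turnstile> Z : Power \<beta>" and T: "ctx w \<turnstile> T : Power \<beta>"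
    and ZT: "\<And>v x. w \<preceq> v \<Longrightarrow> v \<Vdash> x \<^bold>\<in> Z \<Longrightarrow> v \<Vdash> x \<^bold>\<in> pre T \<Longrightarrow> v \<Vdash> x \<^bold>\<in> pre (pre T)"
  shows "w \<Vdash> settled_fm \<beta> f Z T"
  unfolding settled_fm_def
proof (rule holds_forallI)
  fix v x
  assume v: "w \<preceq> v" and x: "ctx v \<turnstile> x : \<beta>"
  interpret V: partial_map v \<beta> A B f
    using v by (rule mono)
  have "v \<Vdash> x \<^bold>\<in> Z \<^bold>\<and> x \<^bold>\<in> pre T \<^bold>\<longrightarrow> x \<^bold>\<in> pre (pre T)"
  proof (rule holds_impI)
    show "ctx v \<turnstile> x \<^bold>\<in> Z \<^bold>\<and> x \<^bold>\<in> pre T : Omega"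
      using x typed_mono[OF Z v] typed_mono[OF T v] by auto
  next
    fix u
    assume "v \<preceq> u" "u \<Vdash> x \<^bold>\<in> Z \<^bold>\<and> x \<^bold>\<in> pre T"
    then show "u \<Vdash> x \<^bold>\<in> pre (pre T)"
      using ZT[OF extends_trans[OF v]] by simp
  qed
  then show "v \<Vdash> inst (Var 0 \<^bold>\<in> lift Z \<^bold>\<and> Var 0 \<^bold>\<in> lift (pre T)
      \<^bold>\<longrightarrow> Var 0 \<^bold>\<in> lift (pre (pre T))) x"
    by (simp add: inst_def)
qed (use Z T in simp)

lemma settledD:
  assumes "w \<Vdash> settled_fm \<beta> f Z T" "w \<Vdash> x \<^bold>\<in> Z" "w \<Vdash> x \<^bold>\<in> pre T"
  shows "w \<Vdash> x \<^bold>\<in> pre (pre T)"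
proof -
  have "ctx w \<turnstile> x : \<beta>"
    using holds_typed[OF assms(1)] mem_typed[OF assms(2)] by simp
  from holds_forallE[OF assms(1)[unfolded settled_fm_def] this]
  have "w \<Vdash> x \<^bold>\<in> Z \<^bold>\<and> x \<^bold>\<in> pre T \<^bold>\<longrightarrow> x \<^bold>\<in> pre (pre T)"
    by (simp add: inst_def)
  with assms(2,3) show ?thesis
    by (metis holds_conj holds_impE)
qed

lemma settles_belowI:
  assumes "w \<Vdash> good_fm \<beta> B f T" "w \<Vdash> subset_fm \<beta> T S" "w \<Vdash> settled_fm \<beta> f Z T"
  shows "w \<Vdash> settles_below_fm \<beta> B f Z S"
  unfolding settles_below_fm_def
proof (rule holds_existsI)
  show "w \<Vdash> inst (good_fm \<beta> (lift B) (lift f) (Var 0) \<^bold>\<and> subset_fm \<beta> (Var 0) (lift S) \<^bold>\<and>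
      settled_fm \<beta> (lift f) (lift Z) (Var 0)) T"
    using assms by (simp add: inst_def)
qed (use assms[THEN holds_typed] in \<open>simp_all add: good_fm_typed settled_fm_typed\<close>)

lemma settles_belowE:
  assumes "w \<Vdash> settles_below_fm \<beta> B f Z S" "ctx w \<turnstile> \<psi> : Omega"
    and "\<And>v T. w \<preceq> v \<Longrightarrow> v \<Vdash> good_fm \<beta> B f T \<Longrightarrow> v \<Vdash> subset_fm \<beta> T S \<Longrightarrow>
      v \<Vdash> settled_fm \<beta> f Z T \<Longrightarrow> v \<Vdash> \<psi>"
  shows "w \<Vdash> \<psi>"
  using assms(1,2) unfolding settles_below_fm_def
  by (rule holds_existsE) (auto simp: inst_def intro: assms(3))

lemma stabilizesI:
  assumes Z: "ctx w \<turnstile> Z : Power \<beta>"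
    and below: "\<And>v S. w \<preceq> v \<Longrightarrow> v \<Vdash> good_fm \<beta> B f S \<Longrightarrow> v \<Vdash> settles_below_fm \<beta> B f Z S"
  shows "w \<Vdash> stabilizes_fm \<beta> B f Z"
  unfolding stabilizes_fm_def
proof (rule holds_forallI)
  fix v S
  assume v: "w \<preceq> v" and S: "ctx v \<turnstile> S : Power \<beta>"
  interpret V: partial_map v \<beta> A B f
    using v by (rule mono)
  have "v \<Vdash> good_fm \<beta> B f S \<^bold>\<longrightarrow> settles_below_fm \<beta> B f Z S"
    by (rule holds_impI) (simp_all add: S below extends_trans[OF v])
  then show "v \<Vdash> inst (good_fm \<beta> (lift B) (lift f) (Var 0) \<^bold>\<longrightarrow>
      settles_below_fm \<beta> (lift B) (lift f) (lift Z) (Var 0)) S"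
    by (simp add: inst_def)
qed (use Z in \<open>simp add: good_fm_typed settles_below_fm_typed\<close>)

lemma stabilizesD:
  assumes "w \<Vdash> stabilizes_fm \<beta> B f Z" "w \<Vdash> good_fm \<beta> B f S"
  shows "w \<Vdash> settles_below_fm \<beta> B f Z S"
proof -
  have "ctx w \<turnstile> S : Power \<beta>"
    using holds_typed[OF assms(2)] by simp
  from holds_forallE[OF assms(1)[unfolded stabilizes_fm_def] this] show ?thesis
    using assms(2) by (simp add: inst_def holds_impE)
qed

text \<open>\<open>S\<close> itself serves, since there is nothing to settle.\<close>

lemma stabilizes_empty: "w \<Vdash> stabilizes_fm \<beta> B f (empty_tm \<beta>)"
proof (rule stabilizesI)
  fix v S
  assume v: "w \<preceq> v" and S: "v \<Vdash> good_fm \<beta> B f S"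
  interpret V: partial_map v \<beta> A B f
    using v by (rule mono)
  have St: "ctx v \<turnstile> S : Power \<beta>"
    using holds_typed[OF S] by simp
  have "v \<Vdash> settled_fm \<beta> f (empty_tm \<beta>) S"
  proof (rule V.settledI)
    fix u x
    assume u: "v \<preceq> u" "u \<Vdash> x \<^bold>\<in> empty_tm \<beta>" "u \<Vdash> x \<^bold>\<in> pre S"
    interpret U: partial_map u \<beta> A B f
      using u(1) by (rule V.mono)
    have "ctx u \<turnstile> x : \<beta>" "ctx u \<turnstile> S : Power \<beta>"
      using mem_typed[OF u(2)] typed_mono[OF St u(1)] by simp_all
    with holds_mem_empty[OF u(2)] show "u \<Vdash> x \<^bold>\<in> pre (pre S)"
      by (auto intro: holds_falsumE)
  qed (simp_all add: St)
  moreover have "v \<Vdash> subset_fm \<beta> S S"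
    using St by (blast intro: holds_subsetI)
  ultimately show "v \<Vdash> settles_below_fm \<beta> B f (empty_tm \<beta>) S"
    using S by (blast intro: V.settles_belowI)
qed simp

text \<open>An element of the enlarged set is in \<open>Z\<close> or equal to \<open>a\<close>. In
  the second case membership in \<open>pre T\<close> is transported to \<open>a\<close>, and the
  conclusion is transported back by symmetry of equality.\<close>

lemma settled_insert:
  assumes ZT: "w \<Vdash> settled_fm \<beta> f Z T" and a: "ctx w \<turnstile> a : \<beta>"
    and aT: "\<And>v. w \<preceq> v \<Longrightarrow> v \<Vdash> a \<^bold>\<in> pre T \<Longrightarrow> v \<Vdash> a \<^bold>\<in> pre (pre T)"
  shows "w \<Vdash> settled_fm \<beta> f (union_tm \<beta> Z (singleton_tm \<beta> a)) T"
proof -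
  have t: "ctx w \<turnstile> Z : Power \<beta>" "ctx w \<turnstile> singleton_tm \<beta> a : Power \<beta>" "ctx w \<turnstile> T : Power \<beta>"
    using holds_typed[OF ZT] a by simp_all
  show ?thesis
  proof (rule settledI)
    fix v x
    assume v: "w \<preceq> v" and x: "v \<Vdash> x \<^bold>\<in> union_tm \<beta> Z (singleton_tm \<beta> a)" and xT: "v \<Vdash> x \<^bold>\<in> pre T"
    note t' = t[THEN typed_mono, OF v]
    have xt: "ctx v \<turnstile> x : \<beta>"
      using x by (rule mem_typed) (use t' in simp)
    from x have "v \<Vdash> x \<^bold>\<in> Z \<^bold>\<or> x \<^bold>\<in> singleton_tm \<beta> a"
      unfolding holds_mem_union[OF xt t'(1,2)] .
    then show "v \<Vdash> x \<^bold>\<in> pre (pre T)"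
    proof (rule holds_disjE)
      fix u
      assume u: "v \<preceq> u" "u \<Vdash> x \<^bold>\<in> Z"
      note wu = extends_trans[OF v u(1)]
      interpret U: partial_map u \<beta> A B f
        using wu by (rule mono)
      show "u \<Vdash> x \<^bold>\<in> pre (pre T)"
        using holds_mono[OF ZT wu] u(2) holds_mono[OF xT u(1)] by (rule U.settledD)
    next
      fix u
      assume u: "v \<preceq> u" "u \<Vdash> x \<^bold>\<in> singleton_tm \<beta> a"
      note wu = extends_trans[OF v u(1)]
      have xa: "u \<Vdash> x \<^bold>= a"
        using u(2) holds_mem_singleton[OF typed_mono[OF xt u(1)] typed_mono[OF a wu]] by simp
      have "u \<Vdash> a \<^bold>\<in> pre T"
        using xa holds_mono[OF xT u(1)] by (rule holds_eq_mem)
      with wu have "u \<Vdash> a \<^bold>\<in> pre (pre T)"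
        by (rule aT)
      with holds_eq_sym[OF xa] show "u \<Vdash> x \<^bold>\<in> pre (pre T)"
        by (rule holds_eq_mem)
    qed
  qed (use t in simp_all)
qed

text \<open>The element \<open>a\<close> itself witnesses that \<open>pre (pre T)\<close> is a
  proper subset of \<open>pre T\<close>.\<close>

lemma good_preimage:
  assumes "w \<Vdash> good_fm \<beta> B f T" "w \<Vdash> a \<^bold>\<in> pre T" "w \<Vdash> \<^bold>\<not> a \<^bold>\<in> pre (pre T)"
  shows "w \<Vdash> good_fm \<beta> B f (pre T)"
  using preimage_complemented[OF goodD(1)[OF assms(1)]] preimage_mono[OF goodD(2)[OF assms(1)]]
    assms(2,3)
  by (rule goodI)

text \<open>After a first use of the hypothesis, two decidable questions about \<open>a\<close> give
  three cases. In two of them the set \<open>T\<close> obtained so far also settles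
  \<open>a\<close>; in the third a second descent starts from \<open>pre T\<close>.\<close>

lemma stabilizes_insert:
  assumes Z: "w \<Vdash> stabilizes_fm \<beta> B f Z" and aA: "w \<Vdash> a \<^bold>\<in> A"
  shows "w \<Vdash> stabilizes_fm \<beta> B f (union_tm \<beta> Z (singleton_tm \<beta> a))"
proof (rule stabilizesI)
  let ?Za = "union_tm \<beta> Z (singleton_tm \<beta> a)"
  have a: "ctx w \<turnstile> a : \<beta>"
    using aA by (rule mem_typed) simp
  have Zt: "ctx w \<turnstile> Z : Power \<beta>"
    using holds_typed[OF Z] by simp
  show "ctx w \<turnstile> ?Za : Power \<beta>"
    using Zt a by simp
  \<comment> \<open>Complementation is relative to \<open>B\<close>, so deciding where
    \<open>a\<close> lies requires \<open>a\<close> to be in \<open>B\<close>.\<close>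
  have aB: "w \<Vdash> a \<^bold>\<in> B"
    using holds_complemented_subset[OF A_complemented] aA by (rule holds_subsetD)
  fix v S
  assume v: "w \<preceq> v" and S: "v \<Vdash> good_fm \<beta> B f S"
  interpret V: partial_map v \<beta> A B f
    using v by (rule mono)
  have St: "ctx v \<turnstile> S : Power \<beta>"
    using holds_typed[OF S] by simp
  have goal: "ctx v \<turnstile> settles_below_fm \<beta> B f ?Za S : Omega"
    using Zt[THEN typed_mono, OF v] a[THEN typed_mono, OF v] St by simp
  have "v \<Vdash> settles_below_fm \<beta> B f Z S"
    using holds_mono[OF Z v] S by (rule V.stabilizesD)
  then show "v \<Vdash> settles_below_fm \<beta> B f ?Za S"
    using goal
  proof (rule V.settles_belowE)
    fix u T
    assume u: "v \<preceq> u" and T: "u \<Vdash> good_fm \<beta> B f T" "u \<Vdash> subset_fm \<beta> T S" "u \<Vdash> settled_fm \<beta> f Z T"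
    interpret U: partial_map u \<beta> A B f
      using u by (rule V.mono)
    note wu = extends_trans[OF v u]
    note a_u = typed_mono[OF a wu] and aB_u = holds_mono[OF aB wu]
    have Tt: "ctx u \<turnstile> T : Power \<beta>"
      using holds_typed[OF T(1)] by simp
    have pre_T: "u \<Vdash> complemented_fm \<beta> (pre T) B"
      using U.goodD(1)[OF T(1)] by (rule U.preimage_complemented)
    from pre_T aB_u have "u \<Vdash> a \<^bold>\<in> pre T \<^bold>\<or> \<^bold>\<not> a \<^bold>\<in> pre T"
      by (rule holds_complementedD)
    then show "u \<Vdash> settles_below_fm \<beta> B f ?Za S"
    proof (rule holds_disjE)
      fix r
      assume r: "u \<preceq> r" "r \<Vdash> \<^bold>\<not> a \<^bold>\<in> pre T"
      interpret R: partial_map r \<beta> A B f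
        using r(1) by (rule U.mono)
      note T_r = T[THEN holds_mono, OF r(1)]
      \<comment> \<open>For \<open>a\<close> the implication is vacuous, as \<open>a\<close> is
        outside \<open>pre T\<close>.\<close>
      have "r \<Vdash> settled_fm \<beta> f ?Za T"
        using T_r(3) typed_mono[OF a_u r(1)]
      proof (rule R.settled_insert)
        fix q
        assume q: "r \<preceq> q" "q \<Vdash> a \<^bold>\<in> pre T"
        interpret Q: partial_map q \<beta> A B f
          using q(1) by (rule R.mono)
        note uq = extends_trans[OF r(1) q(1)]
        show "q \<Vdash> a \<^bold>\<in> pre (pre T)"
          using holds_mono[OF r(2) q(1)] q(2)
          by (rule holds_negE) (use typed_mono[OF a_u uq] typed_mono[OF Tt uq] in auto)
      qed
      with T_r(1,2) show "r \<Vdash> settles_below_fm \<beta> B f ?Za S"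
        by (rule R.settles_belowI)
    next
      fix r
      assume r: "u \<preceq> r" "r \<Vdash> a \<^bold>\<in> pre T"
      interpret R: partial_map r \<beta> A B f
        using r(1) by (rule U.mono)
      from R.preimage_complemented[OF holds_mono[OF pre_T r(1)]] holds_mono[OF aB_u r(1)]
      have "r \<Vdash> a \<^bold>\<in> pre (pre T) \<^bold>\<or> \<^bold>\<not> a \<^bold>\<in> pre (pre T)"
        by (rule holds_complementedD)
      then show "r \<Vdash> settles_below_fm \<beta> B f ?Za S"
      proof (rule holds_disjE)
        fix q
        assume q: "r \<preceq> q" "q \<Vdash> a \<^bold>\<in> pre (pre T)"
        interpret Q: partial_map q \<beta> A B f
          using q(1) by (rule R.mono)
        note uq = extends_trans[OF r(1) q(1)]
        note T_q = T[THEN holds_mono, OF uq]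
        \<comment> \<open>Here the conclusion required of \<open>a\<close> already holds and
          persists.\<close>
        have "q \<Vdash> settled_fm \<beta> f ?Za T"
          using T_q(3) typed_mono[OF a_u uq] by (rule Q.settled_insert) (rule holds_mono[OF q(2)])
        with T_q(1,2) show "q \<Vdash> settles_below_fm \<beta> B f ?Za S"
          by (rule Q.settles_belowI)
      next
        fix q
        assume q: "r \<preceq> q" "q \<Vdash> \<^bold>\<not> a \<^bold>\<in> pre (pre T)"
        interpret Q: partial_map q \<beta> A B f
          using q(1) by (rule R.mono)
        note uq = extends_trans[OF r(1) q(1)]
        note T_q = T[THEN holds_mono, OF uq]
        \<comment> \<open>The remaining case: \<open>a\<close> is in \<open>pre T\<close> but not in
          \<open>pre (pre T)\<close>, so \<open>pre T\<close> is good and the hypothesis can be used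
          below it.\<close>
        have "q \<Vdash> good_fm \<beta> B f (pre T)"
          using T_q(1) holds_mono[OF r(2) q(1)] q(2) by (rule Q.good_preimage)
        with holds_mono[OF Z extends_trans[OF wu uq]]
        have "q \<Vdash> settles_below_fm \<beta> B f Z (pre T)"
          by (rule Q.stabilizesD)
        then show "q \<Vdash> settles_below_fm \<beta> B f ?Za S"
          using typed_mono[OF goal extends_trans[OF u uq]]
        proof (rule Q.settles_belowE)
          fix p T'
          assume p: "q \<preceq> p" and T': "p \<Vdash> good_fm \<beta> B f T'" "p \<Vdash> subset_fm \<beta> T' (pre T)"
            "p \<Vdash> settled_fm \<beta> f Z T'"
          interpret P: partial_map p \<beta> A B f
            using p by (rule Q.mono)
          have T't: "ctx p \<turnstile> T' : Power \<beta>"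
            using holds_typed[OF T'(1)] by simp
          have a_p: "ctx p \<turnstile> a : \<beta>"
            using a_u extends_trans[OF uq p] by (rule typed_mono)
          have "p \<Vdash> settled_fm \<beta> f ?Za T'"
            using T'(3) a_p
          proof (rule P.settled_insert)
            fix z
            assume z: "p \<preceq> z" "z \<Vdash> a \<^bold>\<in> pre T'"
            interpret Y: partial_map z \<beta> A B f
              using z(1) by (rule P.mono)
            \<comment> \<open>\<open>T'\<close> lies in \<open>pre T\<close>, so its preimage lies
              in \<open>pre (pre T)\<close>, from which \<open>a\<close> is excluded; hence
              \<open>a\<close> is settled vacuously.\<close>
            have "z \<Vdash> a \<^bold>\<in> pre (pre T)"
              using Y.preimage_mono[OF holds_mono[OF T'(2) z(1)]] z(2) by (rule holds_subsetD)
            with holds_mono[OF q(2) extends_trans[OF p z(1)]] show "z \<Vdash> a \<^bold>\<in> pre (pre T')"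
              by (rule holds_negE) (use typed_mono[OF a_p z(1)] typed_mono[OF T't z(1)] in auto)
          qed
          \<comment> \<open>The chain is \<open>T'\<close> in \<open>pre T\<close>, in
            \<open>T\<close>, in \<open>S\<close>; its middle link comes from goodness of
            \<open>T\<close>.\<close>
          moreover have "p \<Vdash> subset_fm \<beta> T' S"
            using T'(2) Q.goodD(2)[OF T_q(1), THEN holds_mono, OF p]
              T_q(2)[THEN holds_mono, OF p]
            by (blast intro: holds_subset_trans)
          ultimately show "p \<Vdash> settles_below_fm \<beta> B f ?Za S"
            using T'(1) by (blast intro: P.settles_belowI)
        qed
      qed
    qed
  qed
qed

lemma stabilizes_finite:
  assumes "w \<Vdash> finite_fm \<beta> A"
  shows "w \<Vdash> stabilizes_fm \<beta> B f A"
proof -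
  \<comment> \<open>Index 0 is the induction variable; the parameters \<open>B\<close> and
    \<open>f\<close> are lifted past it, and instantiation removes the lifts again.\<close>
  let ?Q = "stabilizes_fm \<beta> (lift B) (lift f) (Var 0)"
  have Q: "inst ?Q Z = stabilizes_fm \<beta> B f Z" for Z
    by (simp add: inst_def)
  have "w \<Vdash> inst ?Q A"
    using assms AB_typed(1)
  proof (rule holds_finite_induct)
    show "w \<Vdash> inst ?Q (empty_tm \<beta>)"
      by (simp add: Q stabilizes_empty)
  next
    fix v Z a
    assume v: "w \<preceq> v" "v \<Vdash> inst ?Q Z" "v \<Vdash> a \<^bold>\<in> A"
    interpret V: partial_map v \<beta> A B f
      using v(1) by (rule mono)
    from v(2,3) show "v \<Vdash> inst ?Q (union_tm \<beta> Z (singleton_tm \<beta> a))"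
      unfolding Q by (rule V.stabilizes_insert)
  qed (simp add: stabilizes_fm_typed)
  then show ?thesis
    unfolding Q .
qed

text \<open>The starting point of the descent: preimages stay inside \<open>A\<close>, so
  \<open>b\<close> witnesses properness.\<close>

lemma good_codomain:
  assumes "w \<Vdash> b \<^bold>\<in> B" "w \<Vdash> \<^bold>\<not> b \<^bold>\<in> A"
  shows "w \<Vdash> good_fm \<beta> B f B"
proof (rule goodI)
  note pre_A = preimage_subset_domain[OF AB_typed(2)]
  have BB: "w \<Vdash> subset_fm \<beta> B B"
    by (blast intro: holds_subsetI AB_typed)
  then show "w \<Vdash> complemented_fm \<beta> B B"
  proof (rule holds_complementedI)
    fix v x
    assume "v \<Vdash> x \<^bold>\<in> B"
    then show "v \<Vdash> x \<^bold>\<in> B \<^bold>\<or> \<^bold>\<not> x \<^bold>\<in> B"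
      by (rule holds_disjI1) (use holds_typed[OF \<open>v \<Vdash> x \<^bold>\<in> B\<close>] in simp)
  qed
  show "w \<Vdash> subset_fm \<beta> (pre B) B"
    using pre_A holds_complemented_subset[OF A_complemented] by (rule holds_subset_trans)
  show "w \<Vdash> b \<^bold>\<in> B"
    by (fact assms)
  have b: "ctx w \<turnstile> b : \<beta>"
    using assms(1) by (rule mem_typed) simp
  show "w \<Vdash> \<^bold>\<not> b \<^bold>\<in> pre B"
  proof (rule holds_negI)
    show "ctx w \<turnstile> b \<^bold>\<in> pre B : Omega"
      using b by (auto intro: exI[of _ \<beta>])
    fix v
    assume v: "w \<preceq> v" "v \<Vdash> b \<^bold>\<in> pre B"
    have "v \<Vdash> b \<^bold>\<in> A"
      using holds_mono[OF pre_A v(1)] v(2) by (rule holds_subsetD)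
    with holds_mono[OF assms(2) v(1)] show "v \<Vdash> \<^bold>\<bottom>"
      by (rule holds_negE) simp
  qed
qed

section \<open>An element outside the range\<close>

lemma range_typed [simp]: "ctx w \<turnstile> range_tm \<beta> f : C \<longleftrightarrow> C = Power \<beta>"
  by (auto simp: range_tm_def)

lemma rangeE:
  assumes "w \<Vdash> y \<^bold>\<in> range_tm \<beta> f" "ctx w \<turnstile> \<psi> : Omega"
    and "\<And>v x. w \<preceq> v \<Longrightarrow> v \<Vdash> Tuple x y \<^bold>\<in> f \<Longrightarrow> v \<Vdash> \<psi>"
  shows "w \<Vdash> \<psi>"
proof -
  have "ctx w \<turnstile> y : \<beta>"
    using assms(1) by (rule mem_typed) simp
  then have "w \<Vdash> Exists \<beta> (Tuple (Var 0) (lift y) \<^bold>\<in> lift f)"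
    using assms(1) by (simp add: range_tm_def holds_mem_Compr inst_def)
  then show ?thesis
    using assms(2) by (rule holds_existsE) (simp add: inst_def assms(3))
qed

lemma not_in_range:
  assumes settled: "w \<Vdash> settled_fm \<beta> f A T" and x: "w \<Vdash> x \<^bold>\<in> T" "w \<Vdash> \<^bold>\<not> x \<^bold>\<in> pre T"
  shows "w \<Vdash> \<^bold>\<not> x \<^bold>\<in> range_tm \<beta> f"
proof (rule holds_negI)
  have T: "ctx w \<turnstile> T : Power \<beta>"
    using holds_typed[OF settled] by simp
  then have "ctx w \<turnstile> x : \<beta>"
    using x(1) by (blast intro: mem_typed)
  then show "ctx w \<turnstile> x \<^bold>\<in> range_tm \<beta> f : Omega"
    by (auto intro: exI[of _ \<beta>])
  fix v
  assume v: "w \<preceq> v" "v \<Vdash> x \<^bold>\<in> range_tm \<beta> f"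
  interpret V: partial_map v \<beta> A B f
    using v(1) by (rule mono)
  from v(2) show "v \<Vdash> \<^bold>\<bottom>"
  proof (rule V.rangeE)
    fix u a
    assume u: "v \<preceq> u" "u \<Vdash> Tuple a x \<^bold>\<in> f"
    interpret U: partial_map u \<beta> A B f
      using u(1) by (rule V.mono)
    note wu = extends_trans[OF v(1) u(1)]
    have "u \<Vdash> a \<^bold>\<in> pre T"
      using u(2) holds_mono[OF x(1) wu] by (rule U.preimageI)
    with holds_mono[OF settled wu] U.graph_subset(1)[OF u(2)] have "u \<Vdash> a \<^bold>\<in> pre (pre T)"
      by (rule U.settledD)
    \<comment> \<open>\<open>x\<close> is the value of \<open>a\<close>, so \<open>a\<close> being
      in the second preimage puts \<open>x\<close> into the first, against the assumption.\<close>
    then have "u \<Vdash> x \<^bold>\<in> pre T"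
      using u(2) by (rule U.preimage_value) (simp add: typed_mono[OF T wu])
    with holds_mono[OF x(2) wu] show "u \<Vdash> \<^bold>\<bottom>"
      by (rule holds_negE) simp
  qed simp
qed

text \<open>Three witnesses are unpacked in turn: \<open>b\<close> outside \<open>A\<close>, which
  makes \<open>B\<close> good; a good \<open>T\<close> at which all of \<open>A\<close> is settled;
  and \<open>x\<close> in \<open>T\<close> outside \<open>pre T\<close>, which is the element
  missed.\<close>

lemma range_misses:
  assumes fin: "w \<Vdash> finite_fm \<beta> A" and proper: "w \<Vdash> proper_subset_fm \<beta> A B"
  shows "w \<Vdash> inhabited_fm \<beta> (diff_tm \<beta> B (range_tm \<beta> f))" (is "w \<Vdash> ?\<psi>")
proof -
  have \<psi>: "ctx w \<turnstile> ?\<psi> : Omega"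
    by simp
  have "w \<Vdash> inhabited_fm \<beta> (diff_tm \<beta> B A)"
    using proper by (simp add: proper_subset_fm_def)
  then show ?thesis
    using \<psi>
  proof (rule holds_inhabitedE)
    fix v b
    assume v: "w \<preceq> v" and b: "ctx v \<turnstile> b : \<beta>" "v \<Vdash> b \<^bold>\<in> diff_tm \<beta> B A"
    interpret V: partial_map v \<beta> A B f
      using v by (rule mono)
    have "v \<Vdash> good_fm \<beta> B f B"
      using b by (intro V.good_codomain[of b]) (simp_all add: holds_mem_diff)
    with V.stabilizes_finite[OF holds_mono[OF fin v]] have "v \<Vdash> settles_below_fm \<beta> B f A B"
      by (rule V.stabilizesD)
    then show "v \<Vdash> ?\<psi>"
      using typed_mono[OF \<psi> v]
    proof (rule V.settles_belowE)
      fix u T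
      assume u: "v \<preceq> u" and T: "u \<Vdash> good_fm \<beta> B f T" "u \<Vdash> settled_fm \<beta> f A T"
      interpret U: partial_map u \<beta> A B f
        using u by (rule V.mono)
      have Tt: "ctx u \<turnstile> T : Power \<beta>"
        using holds_typed[OF T(1)] by simp
      from U.goodD(3)[OF T(1)] show "u \<Vdash> ?\<psi>"
      proof (rule holds_inhabitedE)
        show "ctx u \<turnstile> ?\<psi> : Omega"
          by simp
        fix r x
        assume r: "u \<preceq> r" and x: "ctx r \<turnstile> x : \<beta>" "r \<Vdash> x \<^bold>\<in> diff_tm \<beta> T (pre T)"
        interpret R: partial_map r \<beta> A B f
          using r by (rule U.mono)
        have xT: "r \<Vdash> x \<^bold>\<in> T" "r \<Vdash> \<^bold>\<not> x \<^bold>\<in> pre T"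
          using x typed_mono[OF Tt r] by (simp_all add: holds_mem_diff)
        have "r \<Vdash> \<^bold>\<not> x \<^bold>\<in> range_tm \<beta> f"
          using holds_mono[OF T(2) r] xT by (rule R.not_in_range)
        \<comment> \<open>A good set is complemented in \<open>B\<close>, hence included in
          it.\<close>
        moreover have "r \<Vdash> x \<^bold>\<in> B"
          using holds_complemented_subset[OF U.goodD(1)[OF T(1)], THEN holds_mono, OF r] xT(1)
          by (rule holds_subsetD)
        ultimately have "r \<Vdash> x \<^bold>\<in> diff_tm \<beta> B (range_tm \<beta> f)"
          using x(1) by (simp add: holds_mem_diff)
        then show "r \<Vdash> ?\<psi>"
          by (rule holds_inhabitedI) simp
      qed
    qed
  qed
qed

end

theorem theorem2:
  fixes \<beta> :: "'g ty"
  shows "[] | [] \<tturnstile>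
    Forall (Power \<beta>) (Forall (Power \<beta>) (Forall (Power (Times \<beta> \<beta>))
      (let B = Var 2; A = Var 1; f = Var 0 in
        finite_fm \<beta> A \<^bold>\<and> complemented_fm \<beta> A B \<^bold>\<and> proper_subset_fm \<beta> A B \<^bold>\<and> function_fm \<beta> f A B
        \<^bold>\<longrightarrow> inhabited_fm \<beta> (diff_tm \<beta> B (range_tm \<beta> f)))))"
proof -
  \<comment> \<open>The innermost quantifier comes first, in accordance with the indices 0, 1 and 2
    of \<open>f\<close>, \<open>A\<close> and \<open>B\<close>.\<close>
  let ?\<Gamma> = "[Power (Times \<beta> \<beta>), Power \<beta>, Power \<beta>]"
  let ?B = "Var 2 :: 'g tm" and ?A = "Var 1 :: 'g tm" and ?f = "Var 0 :: 'g tm"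
  let ?h = "finite_fm \<beta> ?A \<^bold>\<and> complemented_fm \<beta> ?A ?B \<^bold>\<and> proper_subset_fm \<beta> ?A ?B \<^bold>\<and>
    function_fm \<beta> ?f ?A ?B"
  obtain w :: "'g world" where w: "ctx w = ?\<Gamma>" "hyps w = []"
    by (rule world_exists[of "[]" ?\<Gamma>]) simp_all
  have "w \<Vdash> ?h \<^bold>\<longrightarrow> inhabited_fm \<beta> (diff_tm \<beta> ?B (range_tm \<beta> ?f))"
  proof (rule holds_impI)
    show "ctx w \<turnstile> ?h : Omega"
      by (force simp: w finite_fm_def function_fm_def numeral_2_eq_2)
  next
    fix v
    assume v: "w \<preceq> v" "v \<Vdash> ?h"
    \<comment> \<open>The antecedent, now true at \<open>v\<close>, supplies the locale assumptions
      on the graph and on complementation.\<close>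
    interpret partial_map v \<beta> ?A ?B ?f
    proof
      have "ctx w \<turnstile> ?f : Power (Times \<beta> \<beta>)"
        by (simp add: w)
      then show "ctx v \<turnstile> ?f : Power (Times \<beta> \<beta>)"
        using v(1) by (rule typed_mono)
    qed (use v(2) in simp_all)
    show "v \<Vdash> inhabited_fm \<beta> (diff_tm \<beta> ?B (range_tm \<beta> ?f))"
      using v(2) by (intro range_misses) simp_all
  qed
  then have "?\<Gamma> | [] \<tturnstile> ?h \<^bold>\<longrightarrow> inhabited_fm \<beta> (diff_tm \<beta> ?B (range_tm \<beta> ?f))"
    by (simp add: holds_def w)
  then show ?thesis
    \<comment> \<open>With an empty list of hypotheses there is nothing to lift, so the three
      quantifiers are introduced directly over the derivation in \<open>?\<Gamma>\<close>.\<close>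
    unfolding Let_def by (intro forallI) simp
qed

end
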